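(* Let $\Omega\subset\mathbb R^d$ be a connected open set, let $C_1\ne0$ be a constant totally symmetric $3$-tensor on $\mathbb R^d$, let $f\in C^\infty(\Omega)$, and let $K$ be the $(1,2)$-tensor field associated with $C=fC_1$ by $\langle K(X,Y),Z\rangle=C(X,Y,Z)$. If $\mathcal E_K\equiv0$ on $\Omega$, that is, $$2\,K\bigl(h,(D_hK)(h,h)\bigr)+5\,(D_{K(h,h)}K)(h,h)-4\,(D_hK)\bigl(h,K(h,h)\bigr)=0$$ at every $x\in\Omega$ and for every $h\in\mathbb R^d$, then $f$ is constant. Consequently, if $\Omega\subset\mathbb R^d$ is a connected open set and $C$ is a smooth totally symmetric $3$-tensor field on $\Omega$ with the local midpoint invariance property, and if either $d=1$, or $d$ is arbitrary and $C=fC_1$ with $f\in C^\infty(\Omega)$ and $C_1$ a constant totally symmetric $3$-tensor, then $C$ is constant.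
   Context: $\langle\cdot,\cdot\rangle$ is the Euclidean inner product and $\nabla^E$ the flat Euclidean connection; $D_vK$ is the directional derivative of $K$ in direction $v$. $C$ is constant if $D_vC=0$ for every $v\in\mathbb R^d$. For a smooth totally symmetric $3$-tensor field $C$ on $\Omega$, define $K$ by $\langle K(X,Y),Z\rangle=C(X,Y,Z)$ and $\nabla=\nabla^E+K$, $\nabla^*=\nabla^E-K$. Local midpoint map of a torsion-free connection $D$ on $\Omega$: the map $(P,v)\mapsto(P,\mathrm{Exp}^D_P(v))$ is a diffeomorphism from an open neighborhood of $\Omega\times\{0\}$ onto an open neighborhood $W_D$ of the diagonal $\Delta_\Omega$ of $\Omega\times\Omega$; on $W_D$ put $M_D(P,Q)=\mathrm{Exp}^D_P\bigl(\tfrac12(\mathrm{Exp}^D_P)^{-1}(Q)\bigr)$. $C$ has the local midpoint invariance property if $M_\nabla(P,Q)+M_{\nabla^*}(P,Q)=P+Q$ on an open neighborhood of $\Delta_\Omega$ in $W_\nabla\cap W_{\nabla^*}$. *)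

theory Defs
  imports "HOL-Analysis.Analysis"
begin

section \<open>Smooth maps on open sets\<close>

text \<open>
  Only used for open \<^term>\<open>S\<close>, in finite dimension, where these are the usual classes
  \<open>C\<^sup>k\<close> and \<open>C\<^sup>\<infinity>\<close>; the values outside \<^term>\<open>S\<close> are then irrelevant.
\<close>

fun Ck_on :: "nat \<Rightarrow> 'a::real_normed_vector set \<Rightarrow> ('a \<Rightarrow> 'b::real_normed_vector) \<Rightarrow> bool" where
  "Ck_on 0 S f \<longleftrightarrow> continuous_on S f"
| "Ck_on (Suc k) S f \<longleftrightarrow>
     f differentiable_on S \<and> (\<forall>v. Ck_on k S (\<lambda>x. frechet_derivative f (at x) v))"

definition smooth_on :: "'a::real_normed_vector set \<Rightarrow> ('a \<Rightarrow> 'b::real_normed_vector) \<Rightarrow> bool" where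
  "smooth_on S f \<longleftrightarrow> (\<forall>k. Ck_on k S f)"

definition diffeomorphic_via ::
  "'a::real_normed_vector set \<Rightarrow> 'b::real_normed_vector set \<Rightarrow> ('a \<Rightarrow> 'b) \<Rightarrow> bool" where
  "diffeomorphic_via U W F \<longleftrightarrow> open U \<and> open W \<and>
     (\<exists>G. homeomorphism U W F G \<and> smooth_on U F \<and> smooth_on W G)"

definition dir_deriv ::
  "'a::real_normed_vector \<Rightarrow> ('a \<Rightarrow> 'b::real_normed_vector) \<Rightarrow> 'a \<Rightarrow> 'b" where
  "dir_deriv v F x = vector_derivative (\<lambda>t. F (x + t *\<^sub>R v)) (at 0)"


section \<open>Totally symmetric 3-tensors and the associated (1,2)-tensor field\<close>

type_synonym 'a tensor3 = "'a \<Rightarrow> 'a \<Rightarrow> 'a \<Rightarrow> real"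
type_synonym 'a tensor12 = "'a \<Rightarrow> 'a \<Rightarrow> 'a"

definition symmetric_tensor3 :: "'a::euclidean_space tensor3 \<Rightarrow> bool" where
  "symmetric_tensor3 T \<longleftrightarrow>
     (\<forall>y z. linear (\<lambda>x. T x y z)) \<and> (\<forall>x z. linear (\<lambda>y. T x y z)) \<and> (\<forall>x y. linear (\<lambda>z. T x y z)) \<and>
     (\<forall>x y z. T x y z = T y x z) \<and> (\<forall>x y z. T x y z = T x z y)"

text \<open>Tensor fields take the base point as first argument; base points outside \<open>\<Omega>\<close> play no role.\<close>

definition smooth_symmetric_tensor3_field ::
  "'a::euclidean_space set \<Rightarrow> ('a \<Rightarrow> 'a tensor3) \<Rightarrow> bool" where
  "smooth_symmetric_tensor3_field \<Omega> C \<longleftrightarrow>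
     (\<forall>x\<in>\<Omega>. symmetric_tensor3 (C x)) \<and> (\<forall>X Y Z. smooth_on \<Omega> (\<lambda>x. C x X Y Z))"

definition constant_tensor3_field :: "'a::euclidean_space set \<Rightarrow> ('a \<Rightarrow> 'a tensor3) \<Rightarrow> bool" where
  "constant_tensor3_field \<Omega> C \<longleftrightarrow>
     (\<forall>x\<in>\<Omega>. \<forall>v X Y Z. dir_deriv v (\<lambda>y. C y X Y Z) x = 0)"

definition assoc_tensor :: "('a::euclidean_space \<Rightarrow> 'a tensor3) \<Rightarrow> 'a \<Rightarrow> 'a tensor12" where
  "assoc_tensor C x X Y = (THE w. \<forall>Z. w \<bullet> Z = C x X Y Z)"

lemma inner_assoc_tensor:
  assumes "symmetric_tensor3 (C x)"
  shows "assoc_tensor C x X Y \<bullet> Z = C x X Y Z"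
proof -
  have lin: "linear (C x X Y)"
    using assms by (auto simp: symmetric_tensor3_def)
  have "\<exists>!w. \<forall>Z. w \<bullet> Z = C x X Y Z"
  proof (rule ex_ex1I)
    show "\<exists>w. \<forall>Z. w \<bullet> Z = C x X Y Z"
      using adjoint_works[OF lin, of _ 1]
      by (intro exI[of _ "adjoint (C x X Y) 1"]) (simp add: inner_commute)
    show "w = w'" if "\<forall>Z. w \<bullet> Z = C x X Y Z" "\<forall>Z. w' \<bullet> Z = C x X Y Z" for w w'
      using that by (metis vector_eq_rdot)
  qed
  from theI'[OF this] show ?thesis
    unfolding assoc_tensor_def by blast
qed

definition tensor_deriv ::
  "'a::euclidean_space \<Rightarrow> ('a \<Rightarrow> 'a tensor12) \<Rightarrow> 'a \<Rightarrow> 'a tensor12" where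
  "tensor_deriv v K x X Y = dir_deriv v (\<lambda>y. K y X Y) x"

definition obstruction :: "('a::euclidean_space \<Rightarrow> 'a tensor12) \<Rightarrow> 'a \<Rightarrow> 'a \<Rightarrow> 'a" where
  "obstruction K x h =
     2 *\<^sub>R K x h (tensor_deriv h K x h h)
     + 5 *\<^sub>R tensor_deriv (K x h h) K x h h
     - 4 *\<^sub>R tensor_deriv h K x h (K x h h)"


section \<open>Exponential and midpoint maps\<close>

text \<open>
  A torsion-free connection on \<open>\<Omega>\<close> is the sum of the flat connection and a unique symmetric
  (1,2)-tensor field \<open>A\<close>; it is represented by \<open>A\<close>.  The covariant derivative of a vector
  field \<open>V\<close> along a curve \<open>c\<close> is then \<open>V' + A\<^sub>c(c', V)\<close>.  The interval is \<open>[0,1]\<close>, with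
  one-sided derivatives at the end points.
\<close>

definition geodesic ::
  "'a::euclidean_space set \<Rightarrow> ('a \<Rightarrow> 'a tensor12) \<Rightarrow> 'a \<Rightarrow> 'a \<Rightarrow> (real \<Rightarrow> 'a) \<Rightarrow> bool" where
  "geodesic \<Omega> A P v c \<longleftrightarrow> (\<exists>c'. c 0 = P \<and> c' 0 = v \<and>
     (\<forall>t\<in>{0..1}. c t \<in> \<Omega> \<and>
        (c has_vector_derivative c' t) (at t within {0..1}) \<and>
        (\<exists>a. (c' has_vector_derivative a) (at t within {0..1}) \<and> a + A (c t) (c' t) (c' t) = 0)))"

definition exp_domain :: "'a::euclidean_space set \<Rightarrow> ('a \<Rightarrow> 'a tensor12) \<Rightarrow> ('a \<times> 'a) set" where
  "exp_domain \<Omega> A = {(P, v). \<exists>c. geodesic \<Omega> A P v c}"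

definition Exp_map ::
  "'a::euclidean_space set \<Rightarrow> ('a \<Rightarrow> 'a tensor12) \<Rightarrow> 'a \<Rightarrow> 'a \<Rightarrow> 'a" where
  "Exp_map \<Omega> A P v = (THE Q. \<exists>c. geodesic \<Omega> A P v c \<and> c 1 = Q)"

definition exp_pair ::
  "'a::euclidean_space set \<Rightarrow> ('a \<Rightarrow> 'a tensor12) \<Rightarrow> 'a \<times> 'a \<Rightarrow> 'a \<times> 'a" where
  "exp_pair \<Omega> A = (\<lambda>(P, v). (P, Exp_map \<Omega> A P v))"

definition diagonal :: "'a set \<Rightarrow> ('a \<times> 'a) set" where
  "diagonal \<Omega> = {(P, P) |P. P \<in> \<Omega>}"

definition midpoint_chart ::
  "'a::euclidean_space set \<Rightarrow> ('a \<Rightarrow> 'a tensor12) \<Rightarrow> ('a \<times> 'a) set \<Rightarrow> ('a \<times> 'a) set \<Rightarrow> bool" where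
  "midpoint_chart \<Omega> A U W \<longleftrightarrow>
     \<Omega> \<times> {0} \<subseteq> U \<and> U \<subseteq> exp_domain \<Omega> A \<and> diagonal \<Omega> \<subseteq> W \<and> W \<subseteq> \<Omega> \<times> \<Omega> \<and>
     diffeomorphic_via U W (exp_pair \<Omega> A)"

text \<open>For \<open>(P,Q) \<in> W\<close>, the second component of the inverse below is the inverse of
  \<open>Exp\<^sub>P\<close> at \<open>Q\<close> singled out by the chart.\<close>

definition midpoint_map ::
  "'a::euclidean_space set \<Rightarrow> ('a \<Rightarrow> 'a tensor12) \<Rightarrow> ('a \<times> 'a) set \<Rightarrow> 'a \<Rightarrow> 'a \<Rightarrow> 'a" where
  "midpoint_map \<Omega> A U P Q =
     Exp_map \<Omega> A P ((1/2) *\<^sub>R snd (inv_into U (exp_pair \<Omega> A) (P, Q)))"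

text \<open>
  Two charts of the same connection give the same midpoint map near the diagonal, so the property
  does not depend on their choice.
\<close>

definition local_midpoint_invariance ::
  "'a::euclidean_space set \<Rightarrow> ('a \<Rightarrow> 'a tensor3) \<Rightarrow> bool" where
  "local_midpoint_invariance \<Omega> C \<longleftrightarrow>
     (let K = assoc_tensor C; K' = (\<lambda>x X Y. - assoc_tensor C x X Y) in
      \<exists>U W U' W' N. midpoint_chart \<Omega> K U W \<and> midpoint_chart \<Omega> K' U' W' \<and>
        open N \<and> diagonal \<Omega> \<subseteq> N \<and> N \<subseteq> W \<inter> W' \<and>
        (\<forall>(P, Q)\<in>N. midpoint_map \<Omega> K U P Q + midpoint_map \<Omega> K' U' P Q = P + Q))"

end

theory Submission
  imports Defs
begin

text \<open>
  Write \<open>C = f C\<^sub>1\<close> and let \<open>k\<close> be the constant symmetric bilinear product with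
  \<open>k X Y \<bullet> Z = C\<^sub>1 X Y Z\<close>; in dimension one every field has this form.  The associated tensor
  is \<open>K = f k\<close>, and \<open>\<E>\<^sub>K(h) = 0\<close> reads \<open>f (5 df(\<kappa>) \<kappa> - 2 df(h) k(h, \<kappa>)) = 0\<close> with
  \<open>\<kappa> = k(h, h)\<close>.

  Why this forces \<open>f\<close> to be constant: let \<open>e\<close> be a critical point of the cubic form of \<open>C\<^sub>1\<close>
  on the unit sphere at which the form does not vanish, so that \<open>k e e = \<mu> e\<close> with \<open>\<mu> \<noteq> 0\<close>.  Where \<open>f \<noteq> 0\<close>,
  put \<open>h = e + t v\<close> and compare powers of \<open>t\<close>, writing \<open>l = df\<close> and \<open>L = k e\<close>: order 0 gives
  \<open>l(e) = 0\<close>, order 1 gives \<open>l(L v) = (\<mu>/5) l(v)\<close>, and \<open>l\<close> applied to order 2 gives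
  \<open>(6/25) \<mu>\<^sup>2 l(v)\<^sup>2 = 0\<close>.  Hence \<open>f df = 0\<close> on \<open>\<Omega>\<close>, so \<open>f\<^sup>2\<close> is constant and so is the
  continuous function \<open>f\<close> (\<open>quartic_identity_forces_zero\<close>, \<open>quartic_identity_imp_constant\<close>).

  Why midpoint invariance gives \<open>\<E>\<^sub>K = 0\<close>: take a \<open>\<nabla>\<close>-geodesic \<open>\<gamma>\<close> through \<open>x\<close> with velocity
  \<open>u\<close>.  The \<open>\<nabla>\<close>-midpoint of \<open>\<gamma>(-s)\<close> and \<open>\<gamma>(s)\<close> is \<open>x\<close>, so invariance says that the
  \<open>\<nabla>\<^sup>*\<close>-geodesic \<open>b\<^sub>s\<close> on \<open>[-s, s]\<close> joining the same points satisfies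
  \<open>b\<^sub>s(0) = \<gamma>(s) + \<gamma>(-s) - x\<close>.  Working from the midpoint makes first differences odd and second
  differences even in \<open>s\<close>.  First differences up to \<open>o(s\<^sup>3)\<close> determine
  \<open>(b\<^sub>s'(0) - u)/s\<^sup>2\<close> in the limit, the second difference of \<open>\<gamma>\<close> determines the limit of
  \<open>(b\<^sub>s(0) - x)/s\<^sup>2\<close>, and the two second differences, which cancel exactly, are compared up to
  \<open>o(s\<^sup>4)\<close>.  The terms odd in \<open>K\<close> drop out, and what is left is \<open>\<E>\<^sub>K(u) = 0\<close>
  (\<open>spray_second_difference\<close>, \<open>conjugate_midpoint_curves_obstruction\<close>).

  The expansions need \<open>b\<^sub>s\<close> and its velocity to converge uniformly on \<open>[-s, s]\<close>.  This comes from
  the chart: the exponential map is locally Lipschitz, so short geodesics are almost straight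
  (\<open>short_geodesics_nearly_straight\<close>).  Uniqueness of geodesics identifies the curves with values
  of the exponential map.
\<close>

section \<open>Calculus of smooth maps\<close>

lemma Ck_on_has_derivative:
  assumes "Ck_on (Suc n) S f" "open S" "x \<in> S"
  shows "(f has_derivative frechet_derivative f (at x)) (at x)"
  using assms by (metis Ck_on.simps(2) differentiable_on_eq_differentiable_at frechet_derivative_works)

lemma Ck_on_continuous_on:
  assumes "Ck_on n S f" shows "continuous_on S f"
proof (cases n)
  case 0 then show ?thesis using assms by simp
next
  case (Suc m) then show ?thesis
    using assms Ck_on.simps(2)[of m S f] differentiable_imp_continuous_on by blast
qed

lemma smooth_on_partial:
  assumes "smooth_on S f" shows "smooth_on S (\<lambda>x. frechet_derivative f (at x) v)"
  using assms unfolding smooth_on_def by (metis Ck_on.simps(2))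

lemma smooth_on_has_derivative:
  assumes "smooth_on S f" "open S" "x \<in> S"
  shows "(f has_derivative frechet_derivative f (at x)) (at x)"
  using assms Ck_on_has_derivative unfolding smooth_on_def by blast

lemma smooth_on_continuous_on: "smooth_on S f \<Longrightarrow> continuous_on S f"
  unfolding smooth_on_def using Ck_on_continuous_on by blast

lemma smooth_on_tendsto:
  assumes "smooth_on S f" "open S" "x \<in> S" "(c \<longlongrightarrow> x) F"
  shows "((\<lambda>s. f (c s)) \<longlongrightarrow> f x) F"
proof -
  have "isCont f x"
    using assms smooth_on_continuous_on continuous_on_eq_continuous_at by blast
  then show ?thesis using assms(4) isCont_tendsto_compose by blast
qed

lemma frechet_derivative_linear:
  assumes "smooth_on \<Omega> \<phi>" "open \<Omega>" "x \<in> \<Omega>"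
  shows "frechet_derivative \<phi> (at x) (r *\<^sub>R w) = r *\<^sub>R frechet_derivative \<phi> (at x) w"
    "frechet_derivative \<phi> (at x) (- w) = - frechet_derivative \<phi> (at x) w"
    "frechet_derivative \<phi> (at x) (w + w') = frechet_derivative \<phi> (at x) w + frechet_derivative \<phi> (at x) w'"
  using smooth_on_has_derivative[OF assms] has_derivative_linear linear_scale linear_neg linear_add by blast+

lemma frechet_derivative_expand_Basis:
  fixes f :: "'a::euclidean_space \<Rightarrow> 'b::real_normed_vector"
  assumes "smooth_on S f" "open S" "x \<in> S"
  shows "frechet_derivative f (at x) w = (\<Sum>b\<in>Basis. (w \<bullet> b) *\<^sub>R frechet_derivative f (at x) b)"
proof -
  have "linear (frechet_derivative f (at x))"
    using smooth_on_has_derivative[OF assms] has_derivative_linear by blast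
  then have "frechet_derivative f (at x) (\<Sum>b\<in>Basis. (w \<bullet> b) *\<^sub>R b) = (\<Sum>b\<in>Basis. (w \<bullet> b) *\<^sub>R frechet_derivative f (at x) b)"
    by (simp add: linear_sum linear_scale)
  then show ?thesis by (simp add: euclidean_representation)
qed

text \<open>
  Expanding the differential in a basis turns the continuity of each directional derivative, which
  is what \<^const>\<open>smooth_on\<close> provides, into joint continuity in the point and the direction.
\<close>
lemma frechet_derivative_tendsto:
  fixes f :: "'a::euclidean_space \<Rightarrow> 'b::real_normed_vector"
  assumes f: "smooth_on S f" "open S" "x \<in> S" and c: "(c \<longlongrightarrow> x) F" and v: "(v \<longlongrightarrow> u) F"
  shows "((\<lambda>s. frechet_derivative f (at (c s)) (v s)) \<longlongrightarrow> frechet_derivative f (at x) u) F"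
proof -
  have "((\<lambda>s. \<Sum>b\<in>Basis. (v s \<bullet> b) *\<^sub>R frechet_derivative f (at (c s)) b)
     \<longlongrightarrow> (\<Sum>b\<in>Basis. (u \<bullet> b) *\<^sub>R frechet_derivative f (at x) b)) F"
    by (intro tendsto_intros v smooth_on_tendsto[OF smooth_on_partial[OF f(1)] f(2,3) c])
  moreover have "\<forall>\<^sub>F s in F. c s \<in> S"
    using c f topological_tendstoD by blast
  ultimately show ?thesis
    unfolding frechet_derivative_expand_Basis[OF f, symmetric]
    by (rule Lim_transform_eventually[OF _ eventually_mono])
      (simp add: frechet_derivative_expand_Basis[OF f(1,2), symmetric])
qed

lemma smooth_on_locally_Lipschitz:
  fixes f :: "'a::euclidean_space \<Rightarrow> 'b::real_normed_vector"
  assumes f: "smooth_on S f" "open S" "x \<in> S"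
  obtains r L where "r > 0" "L > 0" "cball x r \<subseteq> S" "L-lipschitz_on (cball x r) f"
proof -
  obtain r where r: "r > 0" "cball x r \<subseteq> S"
    using f by (meson open_contains_cball)
  define B where "B y = (\<Sum>b\<in>Basis. norm (frechet_derivative f (at y) b))" for y
  have "continuous_on (cball x r) B"
    unfolding B_def
    by (intro continuous_intros continuous_on_subset[OF smooth_on_continuous_on[OF smooth_on_partial[OF f(1)]] r(2)])
  then have "bounded (B ` cball x r)"
    by (intro compact_imp_bounded compact_continuous_image) auto
  then obtain L where L: "L > 0" "\<And>y. y \<in> cball x r \<Longrightarrow> norm (B y) \<le> L"
    by (auto simp: bounded_pos)
  have "norm (f y - f z) \<le> L * norm (y - z)" if "y \<in> cball x r" "z \<in> cball x r" for y z
  proof (rule differentiable_bound[OF _ _ _ that])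
    show "convex (cball x r)" by simp
    fix y assume y: "y \<in> cball x r"
    then have yS: "y \<in> S" using r by blast
    show "(f has_derivative frechet_derivative f (at y)) (at y within cball x r)"
      using smooth_on_has_derivative[OF f(1,2) yS] has_derivative_at_withinI by blast
    have "norm (frechet_derivative f (at y) w) \<le> L * norm w" for w
    proof -
      have "norm (frechet_derivative f (at y) w) \<le> (\<Sum>b\<in>Basis. norm ((w \<bullet> b) *\<^sub>R frechet_derivative f (at y) b))"
        by (subst frechet_derivative_expand_Basis[OF f(1,2) yS]) (rule norm_sum)
      also have "\<dots> \<le> (\<Sum>b\<in>Basis. norm w * norm (frechet_derivative f (at y) b))"
        by (intro sum_mono) (simp add: Basis_le_norm mult_right_mono)
      also have "\<dots> = norm w * B y"
        by (simp add: B_def sum_distrib_left)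
      also have "\<dots> \<le> norm w * L"
        using L(2)[OF y] by (intro mult_left_mono) auto
      finally show ?thesis by (simp add: mult.commute)
    qed
    then show "onorm (frechet_derivative f (at y)) \<le> L"
      using L(1) by (intro onorm_bound) auto
  qed
  then show ?thesis
    using that[OF r(1) L(1) r(2)] L(1) by (auto simp: lipschitz_on_def dist_norm)
qed

text \<open>
  Local Lipschitz bounds become global on a compact set.  The notion of local Lipschitz continuity
  used is that of families with a time parameter, here applied with a single time.
\<close>
lemma smooth_on_Lipschitz_on_compact:
  fixes f :: "'a::euclidean_space \<Rightarrow> 'b::real_normed_vector"
  assumes f: "smooth_on S f" "open S" and C: "compact C" "C \<subseteq> S"
  obtains L where "L-lipschitz_on C f"
proof -
  have "local_lipschitz {0::real} C (\<lambda>_. f)"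
  proof (rule local_lipschitzI)
    fix x assume "x \<in> C"
    then obtain r L where "r > 0" "L > 0" "L-lipschitz_on (cball x r) f"
      using smooth_on_locally_Lipschitz[OF f] C by (metis subsetD)
    then show "\<exists>u>0. \<exists>L. \<forall>t\<in>cball t u \<inter> {0}. L-lipschitz_on (cball x u \<inter> C) f" for t :: real
      by (meson inf_le1 lipschitz_on_subset)
  qed
  from local_lipschitz_compact_implies_lipschitz[OF this C(1)] that show ?thesis
    by (metis compact_sing continuous_on_const singletonI)
qed

lemma onorm_scaleR_left_le:
  fixes z :: "'a::real_normed_vector"
  assumes "norm z \<le> C"
  shows "onorm (\<lambda>h::real. h *\<^sub>R z) \<le> C"
proof (rule onorm_bound)
  show "norm (h *\<^sub>R z) \<le> C * norm h" for h :: real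
    using mult_right_mono[OF assms abs_ge_zero[of h]] by (simp add: mult.commute)
qed (rule order_trans[OF norm_ge_zero assms])

lemma has_vector_derivative_norm_le:
  fixes c :: "real \<Rightarrow> 'a::real_normed_vector"
  assumes d: "(c has_vector_derivative d) (at t within I)" and nt: "at t within I \<noteq> bot"
    and B: "\<And>s. s \<in> I \<Longrightarrow> norm (c s - c t) \<le> B * \<bar>s - t\<bar>"
  shows "norm d \<le> B"
proof (rule field_le_epsilon)
  fix e :: real assume "e > 0"
  then have "\<forall>\<^sub>F y in at t within I. norm (c y - c t - (y - t) *\<^sub>R d) \<le> e * norm (y - t)"
    using d unfolding has_vector_derivative_def has_derivative_within_alt2 by blast
  moreover have "\<forall>\<^sub>F y in at t within I. y \<noteq> t \<and> y \<in> I"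
    by (simp add: eventually_at_filter)
  ultimately have "\<forall>\<^sub>F y in at t within I. norm d \<le> B + e"
  proof eventually_elim
    case (elim y)
    have "norm ((y - t) *\<^sub>R d) \<le> norm (c y - c t) + norm (c y - c t - (y - t) *\<^sub>R d)"
      using norm_triangle_ineq4[of "c y - c t" "c y - c t - (y - t) *\<^sub>R d"] by simp
    also have "\<dots> \<le> (B + e) * \<bar>y - t\<bar>"
      using elim B[of y] by (simp add: distrib_right)
    finally show ?case
      using elim by (simp add: mult.commute)
  qed
  then show "norm d \<le> B + e"
    using nt by (simp add: eventually_const_iff)
qed

text \<open>
  The chain rule along a family that need not be a curve: only the first-order behaviour of
  \<^term>\<open>m\<close> relative to the scale \<^term>\<open>h\<close> matters.
\<close>
lemma difference_quotient_tendsto: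
  fixes f :: "'a::real_normed_vector \<Rightarrow> 'b::real_normed_vector"
  assumes f: "(f has_derivative f') (at x)" and m: "(m \<longlongrightarrow> x) F"
    and r: "((\<lambda>s. (1 / h s) *\<^sub>R (m s - x)) \<longlongrightarrow> r) F"
  shows "((\<lambda>s. (1 / h s) *\<^sub>R (f (m s) - f x)) \<longlongrightarrow> f' r) F"
proof -
  interpret f': bounded_linear f'
    using f has_derivative_bounded_linear by blast
  define e where "e y = norm (f y - f x - f' (y - x)) / norm (y - x)" for y
  have "(e \<longlongrightarrow> e x) (at x)"
    using f unfolding e_def by (simp add: has_derivative_iff_norm)
  then have "(e \<longlongrightarrow> e x) (nhds x)"
    by (simp add: tendsto_at_iff_tendsto_nhds)
  then have "((\<lambda>s. e (m s)) \<longlongrightarrow> 0) F"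
    using filterlim_compose[OF _ m] by (force simp: e_def)
  from tendsto_mult[OF this tendsto_norm[OF r]]
  have lim0: "((\<lambda>s. e (m s) * norm ((1 / h s) *\<^sub>R (m s - x))) \<longlongrightarrow> 0) F"
    by simp
  define X where "X s = (1 / h s) *\<^sub>R (f (m s) - f x) - f' ((1 / h s) *\<^sub>R (m s - x))" for s
  have "norm (X s) = e (m s) * norm ((1 / h s) *\<^sub>R (m s - x))" for s
  proof -
    have "X s = (1 / h s) *\<^sub>R (f (m s) - f x - f' (m s - x))"
      by (simp add: X_def f'.scaleR f'.diff scaleR_diff_right)
    then show ?thesis
      by (cases "m s = x") (simp_all add: e_def f'.zero)
  qed
  then have "((\<lambda>s. norm (X s)) \<longlongrightarrow> 0) F"
    using lim0 by simp
  then have "(X \<longlongrightarrow> 0) F"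
    by (rule tendsto_norm_zero_cancel)
  from tendsto_add[OF this f'.tendsto[OF r]] show ?thesis
    by (simp add: X_def)
qed

text \<open>
  Integrating the bound on the last derivative \<^term>\<open>n\<close> times.  The reference value \<^term>\<open>A\<close> need
  not be \<^term>\<open>D n 0\<close>: later it is the limit of the top derivatives of a whole family of curves, so
  that the remainder is small compared with \<^term>\<open>s ^ n\<close> uniformly in the family.
\<close>
lemma Taylor_one_sided:
  fixes D :: "nat \<Rightarrow> real \<Rightarrow> 'a::real_normed_vector"
  assumes "\<And>i t. i < n \<Longrightarrow> t \<in> {0..s} \<Longrightarrow> (D i has_vector_derivative D (Suc i) t) (at t within {0..s})"
    and "\<And>t. t \<in> {0..s} \<Longrightarrow> norm (D n t - A) \<le> \<epsilon>" and "s \<ge> 0"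
  shows "norm (D 0 s - (\<Sum>i<n. (s^i / fact i) *\<^sub>R D i 0) - (s^n / fact n) *\<^sub>R A) \<le> \<epsilon> * s^n"
  using assms
proof (induction n arbitrary: D s)
  case 0
  then show ?case by simp
next
  case (Suc n)
  have e0: "\<epsilon> \<ge> 0"
    using order_trans[OF norm_ge_zero Suc.prems(2)[of 0]] Suc.prems(3) by simp
  define g where "g t = D 0 t - (\<Sum>i<Suc n. (t^i / fact i) *\<^sub>R D i 0) - (t^Suc n / fact (Suc n)) *\<^sub>R A" for t
  define g' where "g' t = D (Suc 0) t - (\<Sum>i<n. (t^i / fact i) *\<^sub>R D (Suc i) 0) - (t^n / fact n) *\<^sub>R A" for t
  have pw: "((\<lambda>t. (t^Suc i / fact (Suc i)) *\<^sub>R v) has_vector_derivative ((t^i / fact i) *\<^sub>R v)) (at t within X)"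
    for i v t and X :: "real set"
  proof -
    have "((\<lambda>t. t^Suc i / fact (Suc i)) has_real_derivative (t^i / fact i)) (at t within X)"
      using DERIV_cdivide[OF DERIV_pow[of "Suc i" t X], of "fact (Suc i)"]
      by (simp add: divide_simps del: power_Suc)
    then show ?thesis
      using has_vector_derivative_scaleR[OF _ has_vector_derivative_const] by fastforce
  qed
  have gd: "(g has_vector_derivative g' t) (at t within {0..s})" if "t \<in> {0..s}" for t
  proof -
    have "((\<lambda>t. D 0 t - (D 0 0 + (\<Sum>i<n. (t^Suc i / fact (Suc i)) *\<^sub>R D (Suc i) 0)) - (t^Suc n / fact (Suc n)) *\<^sub>R A)
       has_vector_derivative (D (Suc 0) t - (0 + (\<Sum>i<n. (t^i / fact i) *\<^sub>R D (Suc i) 0)) - (t^n / fact n) *\<^sub>R A)) (at t within {0..s})"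
      using Suc.prems(1)[of 0 t] that
      by (intro has_vector_derivative_diff has_vector_derivative_add has_vector_derivative_sum pw has_vector_derivative_const) auto
    moreover have "g = (\<lambda>t. D 0 t - (D 0 0 + (\<Sum>i<n. (t^Suc i / fact (Suc i)) *\<^sub>R D (Suc i) 0)) - (t^Suc n / fact (Suc n)) *\<^sub>R A)"
      unfolding g_def sum.lessThan_Suc_shift by simp
    ultimately show ?thesis by (simp add: g'_def)
  qed
  have gb: "norm (g' t) \<le> \<epsilon> * s^n" if t: "t \<in> {0..s}" for t
  proof -
    have "norm (g' t) \<le> \<epsilon> * t^n"
      unfolding g'_def
    proof (rule Suc.IH[of t "\<lambda>i. D (Suc i)"])
      show "(D (Suc i) has_vector_derivative D (Suc (Suc i)) \<tau>) (at \<tau> within {0..t})" if "i < n" "\<tau> \<in> {0..t}" for i \<tau>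
        using Suc.prems(1)[of "Suc i" \<tau>] that t by (auto intro: has_vector_derivative_within_subset)
    qed (use Suc.prems t in auto)
    also have "\<dots> \<le> \<epsilon> * s^n"
      using t e0 by (intro mult_left_mono power_mono) auto
    finally show ?thesis .
  qed
  have "norm (g s - g 0) \<le> (\<epsilon> * s^n) * norm (s - 0)"
  proof (rule differentiable_bound[of "{0..s}" g "\<lambda>t h. h *\<^sub>R g' t"])
    show "onorm (\<lambda>h. h *\<^sub>R g' t) \<le> \<epsilon> * s^n" if "t \<in> {0..s}" for t
      by (rule onorm_scaleR_left_le[OF gb[OF that]])
  qed (use gd Suc.prems(3) in \<open>auto simp: has_vector_derivative_def\<close>)
  moreover have "g 0 = 0"
    unfolding g_def sum.lessThan_Suc_shift by simp
  ultimately show ?case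
    using Suc.prems(3) by (simp add: g_def mult_ac)
qed

section \<open>Geodesics as curves of a quadratic spray\<close>

text \<open>
  The equation \<open>c'' = \<phi>(c) k(c', c')\<close> as a first-order system with \<^term>\<open>v\<close> for the velocity.
  For the connection with tensor \<open>f k\<close> the geodesics are the curves with \<open>\<phi> = f\<close> and product
  \<open>- k\<close>, for the conjugate connection those with product \<open>k\<close>; the sign is put on the
  product so that both share one function and one differential.
\<close>
definition spray_curve ::
  "'a::euclidean_space set \<Rightarrow> ('a \<Rightarrow> real) \<Rightarrow> ('a \<Rightarrow> 'a \<Rightarrow> 'a) \<Rightarrow> real set \<Rightarrow> (real \<Rightarrow> 'a) \<Rightarrow> (real \<Rightarrow> 'a) \<Rightarrow> bool" where
  "spray_curve \<Omega> \<phi> k I c v \<longleftrightarrow> (\<forall>t\<in>I. c t \<in> \<Omega> \<and> (c has_vector_derivative v t) (at t within I) \<and>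
     (v has_vector_derivative \<phi> (c t) *\<^sub>R k (v t) (v t)) (at t within I))"

text \<open>
  The right-hand side is homogeneous of degree two in the velocity, so affine changes of time
  preserve the equation; negative factors, which reverse time, are included.
\<close>
lemma spray_curve_affine:
  assumes k: "bilinear k" and sc: "spray_curve \<Omega> \<phi> k I c v" and sub: "\<And>t. t \<in> J \<Longrightarrow> a + \<beta> * t \<in> I"
  shows "spray_curve \<Omega> \<phi> k J (\<lambda>t. c (a + \<beta> * t)) (\<lambda>t. \<beta> *\<^sub>R v (a + \<beta> * t))"
  unfolding spray_curve_def
proof (intro ballI conjI)
  fix t assume t: "t \<in> J"
  let ?g = "\<lambda>t. a + \<beta> * t"
  have g: "(?g has_vector_derivative \<beta>) (at t within J)"
    by (rule derivative_eq_intros refl | simp)+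
  have im: "?g ` J \<subseteq> I" using sub by blast
  from sub[OF t] sc have *: "c (?g t) \<in> \<Omega>" "(c has_vector_derivative v (?g t)) (at (?g t) within I)"
    "(v has_vector_derivative \<phi> (c (?g t)) *\<^sub>R k (v (?g t)) (v (?g t))) (at (?g t) within I)"
    by (auto simp: spray_curve_def)
  show "c (?g t) \<in> \<Omega>" by fact
  show "((\<lambda>t. c (?g t)) has_vector_derivative \<beta> *\<^sub>R v (?g t)) (at t within J)"
    using vector_diff_chain_within[OF g has_vector_derivative_within_subset[OF *(2) im]] by (simp add: o_def)
  have "((\<lambda>t. v (?g t)) has_vector_derivative \<beta> *\<^sub>R \<phi> (c (?g t)) *\<^sub>R k (v (?g t)) (v (?g t))) (at t within J)"
    using vector_diff_chain_within[OF g has_vector_derivative_within_subset[OF *(3) im]] by (simp add: o_def)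
  from bounded_linear.has_vector_derivative[OF bounded_linear_scaleR_right this, of \<beta>]
  show "((\<lambda>t. \<beta> *\<^sub>R v (?g t)) has_vector_derivative \<phi> (c (?g t)) *\<^sub>R k (\<beta> *\<^sub>R v (?g t)) (\<beta> *\<^sub>R v (?g t))) (at t within J)"
    by (simp add: bilinear_lmul[OF k] bilinear_rmul[OF k] mult_ac)
qed

lemma spray_curve_subset:
  assumes "spray_curve \<Omega> \<phi> k I c v" "J \<subseteq> I"
  shows "spray_curve \<Omega> \<phi> k J c v"
  using assms unfolding spray_curve_def by (meson has_vector_derivative_within_subset subsetD)

lemma spray_curve_continuous_on:
  assumes "spray_curve \<Omega> \<phi> k I c v"
  shows "continuous_on I c" "continuous_on I v"
  using assms unfolding spray_curve_def
  by (auto simp: continuous_on_eq_continuous_within intro: has_vector_derivative_continuous)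

lemma Gronwall_zero:
  fixes g :: "real \<Rightarrow> real"
  assumes g: "\<And>t. t \<in> {0..s} \<Longrightarrow> (g has_real_derivative g' t) (at t within {0..s})"
    and le: "\<And>t. t \<in> {0..s} \<Longrightarrow> g' t \<le> L * g t" and "g 0 = 0" "\<And>t. g t \<ge> 0" and t: "t \<in> {0..s}"
  shows "g t = 0"
proof -
  define h where "h t = exp (- L * t) * g t" for t
  have "(h has_real_derivative (exp (- L * t) * (g' t - L * g t))) (at t within {0..s})" if "t \<in> {0..s}" for t
    unfolding h_def using g[OF that] by (auto intro!: derivative_eq_intros simp: algebra_simps)
  then have d: "(h has_real_derivative (exp (- L * r) * (g' r - L * g r))) (at r within {0..t})" if "r \<in> {0..t}" for r
    using that t by (meson DERIV_subset atLeastAtMost_iff atLeastatMost_subset_iff order_trans order_refl)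
  have "h t \<le> h 0"
  proof (cases "t = 0")
    case False
    then have "0 < t" using t by simp
    show ?thesis
    proof (rule DERIV_nonpos_imp_decreasing_open[of 0 t h])
      fix r assume r: "0 < r" "r < t"
      then have "(h has_real_derivative (exp (- L * r) * (g' r - L * g r))) (at r)"
        using d[of r] by (simp add: at_within_Icc_at)
      moreover have "exp (- L * r) * (g' r - L * g r) \<le> 0"
        using le[of r] r t by (simp add: mult_le_0_iff)
      ultimately show "\<exists>y. (h has_real_derivative y) (at r) \<and> y \<le> 0"
        by blast
    next
      show "continuous_on {0..t} h"
        unfolding continuous_on_eq_continuous_within using d DERIV_continuous by blast
    qed (use \<open>0 < t\<close> in simp)
  qed simp
  then show ?thesis
    using assms(3) assms(4)[of t] by (simp add: h_def mult_le_0_iff)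
qed

text \<open>
  Along two solutions the accelerations differ by at most a constant times the distance of positions
  and velocities, because \<^term>\<open>\<phi>\<close> is Lipschitz on the compact union of the two traces; Gronwall's
  inequality applies to the squared distance.
\<close>
lemma spray_curve_unique:
  assumes \<phi>: "smooth_on \<Omega> \<phi>" "open \<Omega>" and k: "bilinear k"
    and c: "spray_curve \<Omega> \<phi> k {0..1} c v" and d: "spray_curve \<Omega> \<phi> k {0..1} d w"
    and "c 0 = d 0" "v 0 = w 0" and t: "t \<in> {0..1}"
  shows "c t = d t"
proof -
  interpret k: bounded_bilinear k
    using k bilinear_conv_bounded_bilinear by blast
  obtain B where B: "B > 0" "\<And>x y. norm (k x y) \<le> norm x * norm y * B"
    using k.pos_bounded by blast
  let ?I = "{0..1::real}"
  note cont = spray_curve_continuous_on[OF c] spray_curve_continuous_on[OF d]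
  define C where "C = c ` ?I \<union> d ` ?I"
  have C: "compact C" "C \<subseteq> \<Omega>"
    using cont c d by (auto simp: C_def spray_curve_def intro!: compact_Un compact_continuous_image)
  obtain L where L: "L-lipschitz_on C \<phi>"
    using smooth_on_Lipschitz_on_compact[OF \<phi> C] by blast
  have "bounded (\<phi> ` C)"
    by (intro compact_imp_bounded compact_continuous_image C continuous_on_subset[OF smooth_on_continuous_on[OF \<phi>(1)]])
  then obtain F where F: "F > 0" "\<And>x. x \<in> C \<Longrightarrow> \<bar>\<phi> x\<bar> \<le> F"
    by (auto simp: bounded_pos)
  have "bounded (v ` ?I \<union> w ` ?I)"
    using cont by (auto intro!: compact_imp_bounded compact_continuous_image)
  then obtain V where V: "V > 0" "\<And>r. r \<in> ?I \<Longrightarrow> norm (v r) \<le> V" "\<And>r. r \<in> ?I \<Longrightarrow> norm (w r) \<le> V"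
    unfolding bounded_pos by blast
  have L0: "L \<ge> 0" using L lipschitz_on_nonneg by blast
  define M where "M = L * (V * V * B) + F * (2 * V * B)"
  have M0: "M \<ge> 0" using L0 F V B by (simp add: M_def)
  define a where "a r = \<phi> (c r) *\<^sub>R k (v r) (v r) - \<phi> (d r) *\<^sub>R k (w r) (w r)" for r
  have a: "norm (a r) \<le> M * (norm (c r - d r) + norm (v r - w r))" if r: "r \<in> ?I" for r
  proof -
    have b: "\<bar>\<phi> (c r) - \<phi> (d r)\<bar> \<le> L * norm (c r - d r)"
      using lipschitz_onD[OF L, of "c r" "d r"] r by (auto simp: C_def dist_norm)
    have b': "\<bar>\<phi> (d r)\<bar> \<le> F"
      using F(2) r by (auto simp: C_def)
    have kB: "norm (k x y) \<le> X * Y * B" if "norm x \<le> X" "norm y \<le> Y" for x y X Y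
    proof -
      have "norm x * norm y \<le> X * Y"
        using that order_trans[OF norm_ge_zero that(1)] by (intro mult_mono) auto
      then show ?thesis
        using order_trans[OF B(2)] B(1) by (meson less_imp_le mult_right_mono)
    qed
    have k1: "norm (k (v r) (v r)) \<le> V * V * B"
      and k2: "norm (k (v r - w r) (v r)) \<le> norm (v r - w r) * V * B"
      and k3: "norm (k (w r) (v r - w r)) \<le> V * norm (v r - w r) * B"
      using V r by (auto intro!: kB)
    have eq: "a r = (\<phi> (c r) - \<phi> (d r)) *\<^sub>R k (v r) (v r) + \<phi> (d r) *\<^sub>R (k (v r - w r) (v r) + k (w r) (v r - w r))"
      by (simp add: a_def k.diff_left k.diff_right algebra_simps)
    have "norm (a r) \<le> \<bar>\<phi> (c r) - \<phi> (d r)\<bar> * norm (k (v r) (v r)) + \<bar>\<phi> (d r)\<bar> * (norm (k (v r - w r) (v r)) + norm (k (w r) (v r - w r)))"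
      unfolding eq by (rule order_trans[OF norm_triangle_ineq]) (simp add: mult_left_mono norm_triangle_ineq)
    also have "\<dots> \<le> (L * norm (c r - d r)) * (V * V * B) + F * (norm (v r - w r) * V * B + V * norm (v r - w r) * B)"
      by (rule add_mono[OF mult_mono[OF b k1] mult_mono[OF b' add_mono[OF k2 k3]]]) (use L0 F(1) in simp_all)
    also have "\<dots> \<le> M * (norm (c r - d r) + norm (v r - w r))"
    proof -
      have "0 \<le> F * (2 * V * B) * norm (c r - d r)" "0 \<le> L * (V * V * B) * norm (v r - w r)"
        using L0 F V B by simp_all
      moreover have "(L * norm (c r - d r)) * (V * V * B) + F * (norm (v r - w r) * V * B + V * norm (v r - w r) * B)
        = M * (norm (c r - d r) + norm (v r - w r)) - F * (2 * V * B) * norm (c r - d r) - L * (V * V * B) * norm (v r - w r)"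
        by (simp add: M_def algebra_simps)
      ultimately show ?thesis by linarith
    qed
    finally show ?thesis .
  qed
  define g where "g r = (c r - d r) \<bullet> (c r - d r) + (v r - w r) \<bullet> (v r - w r)" for r
  define g' where "g' r = 2 * ((c r - d r) \<bullet> (v r - w r)) + 2 * ((v r - w r) \<bullet> a r)" for r
  have "g t = 0"
  proof (rule Gronwall_zero[of 1 g g' "1 + 3 * M"])
    fix r assume r: "r \<in> ?I"
    have "((\<lambda>r. c r - d r) has_vector_derivative v r - w r) (at r within ?I)"
      "((\<lambda>r. v r - w r) has_vector_derivative a r) (at r within ?I)"
      using c d r unfolding spray_curve_def a_def by (blast intro: has_vector_derivative_diff)+
    then have "(g has_vector_derivative ((c r - d r) \<bullet> (v r - w r) + (v r - w r) \<bullet> (c r - d r))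
       + ((v r - w r) \<bullet> a r + a r \<bullet> (v r - w r))) (at r within ?I)"
      unfolding g_def
      by (intro has_vector_derivative_add bounded_bilinear.has_vector_derivative[OF bounded_bilinear_inner])
    then show "(g has_real_derivative g' r) (at r within ?I)"
      unfolding has_real_derivative_iff_has_vector_derivative g'_def by (simp add: inner_commute)
    define x y where "x = norm (c r - d r)" and "y = norm (v r - w r)"
    have xy: "2 * x * y \<le> x^2 + y^2"
      by (rule sum_squares_bound)
    have "(c r - d r) \<bullet> (v r - w r) \<le> x * y" "(v r - w r) \<bullet> a r \<le> y * (M * (x + y))"
      unfolding x_def y_def
      by (rule norm_cauchy_schwarz) (rule order_trans[OF norm_cauchy_schwarz mult_left_mono[OF a[OF r]]], simp)
    then have "g' r \<le> 2 * (x * y) + 2 * (y * (M * (x + y)))"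
      by (simp add: g'_def)
    also have "\<dots> = 2 * x * y + M * (2 * x * y) + 2 * M * y^2"
      by (simp add: algebra_simps power2_eq_square)
    also have "\<dots> \<le> (x^2 + y^2) + M * (x^2 + y^2) + 2 * M * (x^2 + y^2)"
      using xy M0 by (intro add_mono mult_left_mono) auto
    also have "\<dots> = (1 + 3 * M) * g r"
      by (simp add: g_def x_def y_def power2_norm_eq_inner algebra_simps)
    finally show "g' r \<le> (1 + 3 * M) * g r" .
  qed (use assms in \<open>auto simp: g_def\<close>)
  then have "(c t - d t) \<bullet> (c t - d t) = 0"
    using inner_ge_zero[of "c t - d t"] inner_ge_zero[of "v t - w t"] unfolding g_def by linarith
  then show ?thesis by simp
qed

text \<open>
  The second derivative of \<^term>\<open>\<phi>\<close> at \<^term>\<open>y\<close> as a quadratic form in \<^term>\<open>w\<close>.  One slot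
  is expanded in the basis because smoothness speaks of the differential in fixed directions.
\<close>
definition hessian_form :: "('a::euclidean_space \<Rightarrow> real) \<Rightarrow> 'a \<Rightarrow> 'a \<Rightarrow> real" where
  "hessian_form \<phi> y w = (\<Sum>b\<in>Basis. (w \<bullet> b) * frechet_derivative (\<lambda>z. frechet_derivative \<phi> (at z) b) (at y) w)"

text \<open>
  The second, third and fourth derivatives of a solution, as functions of its position \<^term>\<open>y\<close>
  and velocity \<^term>\<open>w\<close>; each is the previous one differentiated along the equation.
\<close>
definition acc :: "('a::euclidean_space \<Rightarrow> real) \<Rightarrow> ('a \<Rightarrow> 'a \<Rightarrow> 'a) \<Rightarrow> 'a \<Rightarrow> 'a \<Rightarrow> 'a" where
  "acc \<phi> k y w = \<phi> y *\<^sub>R k w w"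

definition jerk :: "('a::euclidean_space \<Rightarrow> real) \<Rightarrow> ('a \<Rightarrow> 'a \<Rightarrow> 'a) \<Rightarrow> 'a \<Rightarrow> 'a \<Rightarrow> 'a" where
  "jerk \<phi> k y w = frechet_derivative \<phi> (at y) w *\<^sub>R k w w + (2 * \<phi> y) *\<^sub>R k w (acc \<phi> k y w)"

definition snap :: "('a::euclidean_space \<Rightarrow> real) \<Rightarrow> ('a \<Rightarrow> 'a \<Rightarrow> 'a) \<Rightarrow> 'a \<Rightarrow> 'a \<Rightarrow> 'a" where
  "snap \<phi> k y w =
     (hessian_form \<phi> y w + frechet_derivative \<phi> (at y) (acc \<phi> k y w)) *\<^sub>R k w w
     + (4 * frechet_derivative \<phi> (at y) w) *\<^sub>R k w (acc \<phi> k y w)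
     + (2 * \<phi> y) *\<^sub>R (k (acc \<phi> k y w) (acc \<phi> k y w) + k w (jerk \<phi> k y w))"

lemma has_real_derivative_along_curve:
  assumes "smooth_on \<Omega> \<phi>" "open \<Omega>" "c t \<in> \<Omega>" "(c has_vector_derivative v) (at t within I)"
  shows "((\<lambda>t. \<phi> (c t)) has_real_derivative frechet_derivative \<phi> (at (c t)) v) (at t within I)"
proof -
  have "((\<lambda>t. \<phi> (c t)) has_derivative (\<lambda>r. frechet_derivative \<phi> (at (c t)) (r *\<^sub>R v))) (at t within I)"
    using has_derivative_compose[OF assms(4)[unfolded has_vector_derivative_def] smooth_on_has_derivative[OF assms(1-3)]] .
  moreover have "linear (frechet_derivative \<phi> (at (c t)))"
    using smooth_on_has_derivative[OF assms(1-3)] has_derivative_linear by blast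
  ultimately show ?thesis
    by (simp add: has_field_derivative_def linear_scale mult_commute_abs)
qed

lemma has_real_derivative_differential_along_curve:
  assumes \<phi>: "smooth_on \<Omega> \<phi>" "open \<Omega>" and cv: "\<And>t. t \<in> I \<Longrightarrow> c t \<in> \<Omega>" "t \<in> I"
    "(c has_vector_derivative v t) (at t within I)" "(v has_vector_derivative a) (at t within I)"
  shows "((\<lambda>t. frechet_derivative \<phi> (at (c t)) (v t)) has_real_derivative
     hessian_form \<phi> (c t) (v t) + frechet_derivative \<phi> (at (c t)) a) (at t within I)"
proof -
  have "((\<lambda>t. v t \<bullet> b) has_real_derivative a \<bullet> b) (at t within I)" for b
    using bounded_linear.has_vector_derivative[OF bounded_linear_inner_left cv(4)]
    by (simp add: has_real_derivative_iff_has_vector_derivative)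
  then have "((\<lambda>t. \<Sum>b\<in>Basis. (v t \<bullet> b) * frechet_derivative \<phi> (at (c t)) b) has_real_derivative
    (\<Sum>b\<in>Basis. (a \<bullet> b) * frechet_derivative \<phi> (at (c t)) b +
      frechet_derivative (\<lambda>z. frechet_derivative \<phi> (at z) b) (at (c t)) (v t) * (v t \<bullet> b))) (at t within I)"
    by (intro DERIV_sum DERIV_mult
        has_real_derivative_along_curve[OF smooth_on_partial[OF \<phi>(1)] \<phi>(2) cv(1)[OF cv(2)] cv(3)])
  moreover have "(\<Sum>b\<in>Basis. (a \<bullet> b) * frechet_derivative \<phi> (at (c t)) b +
      frechet_derivative (\<lambda>z. frechet_derivative \<phi> (at z) b) (at (c t)) (v t) * (v t \<bullet> b))
    = hessian_form \<phi> (c t) (v t) + frechet_derivative \<phi> (at (c t)) a"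
    unfolding frechet_derivative_expand_Basis[OF \<phi> cv(1)[OF cv(2)], of a] hessian_form_def sum.distrib
    by (simp add: mult.commute)
  ultimately have "((\<lambda>t. \<Sum>b\<in>Basis. (v t \<bullet> b) * frechet_derivative \<phi> (at (c t)) b) has_real_derivative
     hessian_form \<phi> (c t) (v t) + frechet_derivative \<phi> (at (c t)) a) (at t within I)"
    by simp
  moreover have "(\<Sum>b\<in>Basis. (v t \<bullet> b) * frechet_derivative \<phi> (at (c t)) b) = frechet_derivative \<phi> (at (c t)) (v t)" if "t \<in> I" for t
    using frechet_derivative_expand_Basis[OF \<phi> cv(1)[OF that], of "v t"] by simp
  ultimately show ?thesis
    by (rule has_field_derivative_transform_within[OF _ zero_less_one cv(2)])
qed

lemma spray_curve_higher_derivatives: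
  assumes \<phi>: "smooth_on \<Omega> \<phi>" "open \<Omega>" and k: "bilinear k" and sym: "\<And>x y. k x y = k y x"
    and sc: "spray_curve \<Omega> \<phi> k I c v" and t: "t \<in> I"
  shows "((\<lambda>t. acc \<phi> k (c t) (v t)) has_vector_derivative jerk \<phi> k (c t) (v t)) (at t within I)"
    "((\<lambda>t. jerk \<phi> k (c t) (v t)) has_vector_derivative snap \<phi> k (c t) (v t)) (at t within I)"
proof -
  interpret k: bounded_bilinear k
    using k bilinear_conv_bounded_bilinear by blast
  have in\<Omega>: "\<And>t. t \<in> I \<Longrightarrow> c t \<in> \<Omega>" and dc: "(c has_vector_derivative v t) (at t within I)"
    and dv: "(v has_vector_derivative acc \<phi> k (c t) (v t)) (at t within I)"
    using sc t by (auto simp: spray_curve_def acc_def)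
  note d\<phi> = has_real_derivative_along_curve[OF \<phi> in\<Omega>[OF t] dc]
  note dd\<phi> = has_real_derivative_differential_along_curve[OF \<phi> in\<Omega> t dc dv]
  have "((\<lambda>t. \<phi> (c t) *\<^sub>R k (v t) (v t)) has_vector_derivative
     (\<phi> (c t) *\<^sub>R (k (v t) (acc \<phi> k (c t) (v t)) + k (acc \<phi> k (c t) (v t)) (v t))
      + frechet_derivative \<phi> (at (c t)) (v t) *\<^sub>R k (v t) (v t))) (at t within I)"
    by (intro has_vector_derivative_scaleR d\<phi> k.has_vector_derivative dv)
  then show dacc: "((\<lambda>t. acc \<phi> k (c t) (v t)) has_vector_derivative jerk \<phi> k (c t) (v t)) (at t within I)"
    unfolding sym[of "acc \<phi> k (c t) (v t)" "v t"]
    by (simp add: acc_def[of \<phi> k "c _" "v _", symmetric] jerk_def scaleR_2[symmetric] add.commute mult.commute)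
  have "((\<lambda>t. frechet_derivative \<phi> (at (c t)) (v t) *\<^sub>R k (v t) (v t) + (2 * \<phi> (c t)) *\<^sub>R k (v t) (acc \<phi> k (c t) (v t)))
    has_vector_derivative
     (frechet_derivative \<phi> (at (c t)) (v t) *\<^sub>R (k (v t) (acc \<phi> k (c t) (v t)) + k (acc \<phi> k (c t) (v t)) (v t))
      + (hessian_form \<phi> (c t) (v t) + frechet_derivative \<phi> (at (c t)) (acc \<phi> k (c t) (v t))) *\<^sub>R k (v t) (v t))
     + ((2 * \<phi> (c t)) *\<^sub>R (k (v t) (jerk \<phi> k (c t) (v t)) + k (acc \<phi> k (c t) (v t)) (acc \<phi> k (c t) (v t)))
        + (2 * frechet_derivative \<phi> (at (c t)) (v t)) *\<^sub>R k (v t) (acc \<phi> k (c t) (v t)))) (at t within I)"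
    by (intro has_vector_derivative_add has_vector_derivative_scaleR d\<phi> dd\<phi> k.has_vector_derivative dv dacc
         DERIV_cmult)
  then show "((\<lambda>t. jerk \<phi> k (c t) (v t)) has_vector_derivative snap \<phi> k (c t) (v t)) (at t within I)"
    unfolding jerk_def[symmetric] sym[of "acc \<phi> k (c t) (v t)" "v t"]
  proof (rule back_subst[where P = "\<lambda>d. (_ has_vector_derivative d) _"])
    let ?K = "k (v t) (acc \<phi> k (c t) (v t))" and ?l = "frechet_derivative \<phi> (at (c t)) (v t)"
    have eq: "?l *\<^sub>R (?K + ?K) + (2 * ?l) *\<^sub>R ?K = (4 * ?l) *\<^sub>R ?K"
      by (simp flip: scaleR_2 scaleR_left_distrib)
    show "?l *\<^sub>R (?K + ?K)
        + (hessian_form \<phi> (c t) (v t) + frechet_derivative \<phi> (at (c t)) (acc \<phi> k (c t) (v t))) *\<^sub>R k (v t) (v t)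
      + ((2 * \<phi> (c t)) *\<^sub>R (k (v t) (jerk \<phi> k (c t) (v t)) + k (acc \<phi> k (c t) (v t)) (acc \<phi> k (c t) (v t)))
        + (2 * ?l) *\<^sub>R ?K) = snap \<phi> k (c t) (v t)"
      unfolding snap_def eq[symmetric] by (simp only: add_ac)
  qed
qed

section \<open>Symmetric Taylor expansion of spray curves\<close>

context
  fixes \<Omega> :: "'a::euclidean_space set" and \<phi> :: "'a \<Rightarrow> real" and k :: "'a \<Rightarrow> 'a \<Rightarrow> 'a"
  assumes \<phi>: "smooth_on \<Omega> \<phi>" "open \<Omega>" and k: "bilinear k" and sym: "\<And>x y. k x y = k y x"
begin

interpretation k: bounded_bilinear k
  using k bilinear_conv_bounded_bilinear by blast

lemma spray_jets_tendsto:
  assumes x: "x \<in> \<Omega>" and c: "(c \<longlongrightarrow> x) F" and v: "(v \<longlongrightarrow> u) F"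
  shows "((\<lambda>s. jerk \<phi> k (c s) (v s)) \<longlongrightarrow> jerk \<phi> k x u) F"
    "((\<lambda>s. snap \<phi> k (c s) (v s)) \<longlongrightarrow> snap \<phi> k x u) F"
proof -
  note \<phi>_lim = smooth_on_tendsto[OF \<phi> x c]
  note d_lim = frechet_derivative_tendsto[OF \<phi> x c]
  have acc_lim: "((\<lambda>s. acc \<phi> k (c s) (v s)) \<longlongrightarrow> acc \<phi> k x u) F"
    unfolding acc_def by (intro tendsto_scaleR \<phi>_lim k.tendsto v)
  show jerk_lim: "((\<lambda>s. jerk \<phi> k (c s) (v s)) \<longlongrightarrow> jerk \<phi> k x u) F"
    unfolding jerk_def by (intro tendsto_intros \<phi>_lim d_lim k.tendsto v acc_lim)
  have "((\<lambda>s. hessian_form \<phi> (c s) (v s)) \<longlongrightarrow> hessian_form \<phi> x u) F"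
    unfolding hessian_form_def
    by (intro tendsto_intros v frechet_derivative_tendsto[OF smooth_on_partial[OF \<phi>(1)] \<phi>(2) x c])
  then show "((\<lambda>s. snap \<phi> k (c s) (v s)) \<longlongrightarrow> snap \<phi> k x u) F"
    unfolding snap_def by (intro tendsto_intros \<phi>_lim d_lim k.tendsto v acc_lim jerk_lim)
qed

lemma spray_jets_near:
  assumes x: "x \<in> \<Omega>" and "\<epsilon> > 0"
  shows "\<forall>\<^sub>F p in nhds (x, u). norm (jerk \<phi> k (fst p) (snd p) - jerk \<phi> k x u) \<le> \<epsilon>"
    "\<forall>\<^sub>F p in nhds (x, u). norm (snap \<phi> k (fst p) (snd p) - snap \<phi> k x u) \<le> \<epsilon>"
proof -
  have lims: "(fst \<longlongrightarrow> x) (nhds (x, u))" "(snd \<longlongrightarrow> u) (nhds (x, u))"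
    using tendsto_fst[OF filterlim_ident, of "(x, u)"] tendsto_snd[OF filterlim_ident, of "(x, u)"] by simp_all
  show "\<forall>\<^sub>F p in nhds (x, u). norm (jerk \<phi> k (fst p) (snd p) - jerk \<phi> k x u) \<le> \<epsilon>"
    using tendstoD[OF spray_jets_tendsto(1)[OF x lims] \<open>\<epsilon> > 0\<close>]
    by (rule eventually_mono) (simp add: dist_norm)
  show "\<forall>\<^sub>F p in nhds (x, u). norm (snap \<phi> k (fst p) (snd p) - snap \<phi> k x u) \<le> \<epsilon>"
    using tendstoD[OF spray_jets_tendsto(2)[OF x lims] \<open>\<epsilon> > 0\<close>]
    by (rule eventually_mono) (simp add: dist_norm)
qed

text \<open>
  The \<open>j\<close>-th derivative of a solution is homogeneous of degree \<open>j\<close> in the velocity, whence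
  its parity under time reversal.
\<close>
lemma spray_jets_reverse:
  assumes y: "y \<in> \<Omega>"
  shows "acc \<phi> k y (- w) = acc \<phi> k y w" "jerk \<phi> k y (- w) = - jerk \<phi> k y w"
    "snap \<phi> k y (- w) = snap \<phi> k y w"
proof -
  have d: "frechet_derivative \<phi> (at y) (- z) = - frechet_derivative \<phi> (at y) z" for z
    using smooth_on_has_derivative[OF \<phi> y] has_derivative_linear linear_neg by blast
  have d2: "frechet_derivative (\<lambda>z. frechet_derivative \<phi> (at z) b) (at y) (- z)
     = - frechet_derivative (\<lambda>z. frechet_derivative \<phi> (at z) b) (at y) z" for z b
    using smooth_on_has_derivative[OF smooth_on_partial[OF \<phi>(1)] \<phi>(2) y] has_derivative_linear linear_neg by blast
  show a: "acc \<phi> k y (- w) = acc \<phi> k y w"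
    by (simp add: acc_def k.minus_left k.minus_right)
  show j: "jerk \<phi> k y (- w) = - jerk \<phi> k y w"
    by (simp add: jerk_def a d k.minus_left k.minus_right)
  have "hessian_form \<phi> y (- w) = hessian_form \<phi> y w"
    by (simp add: hessian_form_def d2)
  then show "snap \<phi> k y (- w) = snap \<phi> k y w"
    by (simp add: snap_def a j d k.minus_left k.minus_right)
qed

lemma spray_curve_Taylor:
  assumes sc: "spray_curve \<Omega> \<phi> k {0..s} c v" and "s \<ge> 0"
  shows "(\<And>t. t \<in> {0..s} \<Longrightarrow> norm (jerk \<phi> k (c t) (v t) - A) \<le> \<epsilon>) \<Longrightarrow>
      norm (c s - (c 0 + s *\<^sub>R v 0 + (s^2 / 2) *\<^sub>R acc \<phi> k (c 0) (v 0)) - (s^3 / 6) *\<^sub>R A) \<le> \<epsilon> * s^3"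
    and "(\<And>t. t \<in> {0..s} \<Longrightarrow> norm (snap \<phi> k (c t) (v t) - A) \<le> \<epsilon>) \<Longrightarrow>
      norm (c s - (c 0 + s *\<^sub>R v 0 + (s^2 / 2) *\<^sub>R acc \<phi> k (c 0) (v 0) + (s^3 / 6) *\<^sub>R jerk \<phi> k (c 0) (v 0))
        - (s^4 / 24) *\<^sub>R A) \<le> \<epsilon> * s^4"
proof -
  define D where "D i t = [c t, v t, acc \<phi> k (c t) (v t), jerk \<phi> k (c t) (v t), snap \<phi> k (c t) (v t)] ! i" for i t
  have D: "D 0 = c" "D (Suc 0) = v" "D (Suc (Suc 0)) = (\<lambda>t. acc \<phi> k (c t) (v t))"
    "D (Suc (Suc (Suc 0))) = (\<lambda>t. jerk \<phi> k (c t) (v t))"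
    "D (Suc (Suc (Suc (Suc 0)))) = (\<lambda>t. snap \<phi> k (c t) (v t))"
    by (simp_all add: D_def fun_eq_iff)
  have deriv: "(D i has_vector_derivative D (Suc i) t) (at t within {0..s})"
    if "i < Suc (Suc (Suc (Suc 0)))" "t \<in> {0..s}" for i t
  proof -
    have "i = 0 \<or> i = Suc 0 \<or> i = Suc (Suc 0) \<or> i = Suc (Suc (Suc 0))" using that by auto
    moreover have "(c has_vector_derivative v t) (at t within {0..s})"
      "(v has_vector_derivative acc \<phi> k (c t) (v t)) (at t within {0..s})"
      using sc that(2) by (auto simp: spray_curve_def acc_def)
    ultimately show ?thesis
      using spray_curve_higher_derivatives[OF \<phi> k sym sc that(2)]
      by (elim disjE) (simp_all only: D)
  qed
  show "norm (c s - (c 0 + s *\<^sub>R v 0 + (s^2 / 2) *\<^sub>R acc \<phi> k (c 0) (v 0)) - (s^3 / 6) *\<^sub>R A) \<le> \<epsilon> * s^3"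
    if "\<And>t. t \<in> {0..s} \<Longrightarrow> norm (jerk \<phi> k (c t) (v t) - A) \<le> \<epsilon>"
  proof -
    have "norm (D 0 s - (\<Sum>i<Suc (Suc (Suc 0)). (s^i / fact i) *\<^sub>R D i 0)
      - (s^Suc (Suc (Suc 0)) / fact (Suc (Suc (Suc 0)))) *\<^sub>R A) \<le> \<epsilon> * s^Suc (Suc (Suc 0))"
      using deriv that \<open>s \<ge> 0\<close> by (intro Taylor_one_sided) (simp_all add: D)
    then show ?thesis
      by (simp add: D power2_eq_square power3_eq_cube mult.assoc add.assoc)
  qed
  show "norm (c s - (c 0 + s *\<^sub>R v 0 + (s^2 / 2) *\<^sub>R acc \<phi> k (c 0) (v 0) + (s^3 / 6) *\<^sub>R jerk \<phi> k (c 0) (v 0))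
        - (s^4 / 24) *\<^sub>R A) \<le> \<epsilon> * s^4"
    if "\<And>t. t \<in> {0..s} \<Longrightarrow> norm (snap \<phi> k (c t) (v t) - A) \<le> \<epsilon>"
  proof -
    have "norm (D 0 s - (\<Sum>i<Suc (Suc (Suc (Suc 0))). (s^i / fact i) *\<^sub>R D i 0)
      - (s^Suc (Suc (Suc (Suc 0))) / fact (Suc (Suc (Suc (Suc 0))))) *\<^sub>R A) \<le> \<epsilon> * s^Suc (Suc (Suc (Suc 0)))"
      using deriv that \<open>s \<ge> 0\<close> by (intro Taylor_one_sided) (simp_all add: D)
    then show ?thesis
      by (simp add: D power2_eq_square power3_eq_cube power4_eq_xxxx mult.assoc add.assoc)
  qed
qed

end

text \<open>
  For curves \<^term>\<open>c s\<close> on \<open>[-s, s]\<close> whose positions and velocities tend uniformly to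
  \<open>(x, u)\<close>, one-sided Taylor expansions in both time directions are combined: in the difference
  the even derivatives cancel, in the sum the odd ones.  The acceleration at time 0 is kept exact,
  since its own variation with \<^term>\<open>s\<close> has the same order as the fourth-order term.
\<close>
lemma spray_second_difference:
  fixes c v :: "real \<Rightarrow> real \<Rightarrow> 'a::euclidean_space"
  assumes \<phi>: "smooth_on \<Omega> \<phi>" "open \<Omega>" and k: "bilinear k" and sym: "\<And>x y. k x y = k y x"
    and x: "x \<in> \<Omega>" and sc: "\<forall>\<^sub>F s in at_right 0. spray_curve \<Omega> \<phi> k {-s..s} (c s) (v s)"
    and near: "\<And>P. \<forall>\<^sub>F p in nhds (x, u). P p \<Longrightarrow> \<forall>\<^sub>F s in at_right 0. \<forall>\<tau>\<in>{-s..s}. P (c s \<tau>, v s \<tau>)"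
  shows "((\<lambda>s. (1 / s^3) *\<^sub>R (c s s - c s (-s) - (2 * s) *\<^sub>R v s 0)) \<longlongrightarrow> (1/3) *\<^sub>R jerk \<phi> k x u) (at_right 0)"
    and "((\<lambda>s. (1 / s^4) *\<^sub>R (c s s + c s (-s) - 2 *\<^sub>R c s 0 - s^2 *\<^sub>R acc \<phi> k (c s 0) (v s 0)))
           \<longlongrightarrow> (1/12) *\<^sub>R snap \<phi> k x u) (at_right 0)"
proof -
  have pos: "\<forall>\<^sub>F s::real in at_right 0. s > 0"
    by (simp add: eventually_at_right_less)
  let ?b = "\<lambda>s t. c s (0 + (-1) * t)" and ?w = "\<lambda>s t. (-1) *\<^sub>R v s (0 + (-1) * t)"
  have halves: "spray_curve \<Omega> \<phi> k {0..s} (c s) (v s)" "spray_curve \<Omega> \<phi> k {0..s} (?b s) (?w s)" 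
    "c s 0 \<in> \<Omega>"
    if "spray_curve \<Omega> \<phi> k {-s..s} (c s) (v s)" "s > 0" for s
    using that spray_curve_subset[OF that(1), of "{0..s}"] spray_curve_affine[OF k that(1), of "{0..s}" 0 "-1"]
    by (auto simp: spray_curve_def[of _ _ _ "{-s..s}"])
  note rev = spray_jets_reverse[OF \<phi> k sym]
  show "((\<lambda>s. (1 / s^3) *\<^sub>R (c s s - c s (-s) - (2 * s) *\<^sub>R v s 0)) \<longlongrightarrow> (1/3) *\<^sub>R jerk \<phi> k x u) (at_right 0)"
  proof (rule tendstoI)
    fix \<epsilon> :: real assume "\<epsilon> > 0"
    define A where "A = jerk \<phi> k x u"
    have "\<forall>\<^sub>F s in at_right 0. \<forall>\<tau>\<in>{-s..s}. norm (jerk \<phi> k (c s \<tau>) (v s \<tau>) - A) \<le> \<epsilon> / 3"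
      using near[OF spray_jets_near(1)[OF \<phi> k sym x, of "\<epsilon> / 3" u]] \<open>\<epsilon> > 0\<close> by (simp add: A_def)
    with pos sc show "\<forall>\<^sub>F s in at_right 0. dist ((1 / s^3) *\<^sub>R (c s s - c s (-s) - (2 * s) *\<^sub>R v s 0)) ((1/3) *\<^sub>R A) < \<epsilon>"
    proof eventually_elim
      case (elim s)
      note h = halves[OF elim(2,1)]
      have in\<Omega>: "c s t \<in> \<Omega>" if "t \<in> {-s..s}" for t
        using elim(2) that by (auto simp: spray_curve_def)
      define p where "p = c s 0 + (s^2 / 2) *\<^sub>R acc \<phi> k (c s 0) (v s 0)"
      define X where "X = c s s - (c s 0 + s *\<^sub>R v s 0 + (s^2 / 2) *\<^sub>R acc \<phi> k (c s 0) (v s 0)) - (s^3 / 6) *\<^sub>R A"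
      define Y where "Y = ?b s s - (?b s 0 + s *\<^sub>R ?w s 0 + (s^2 / 2) *\<^sub>R acc \<phi> k (?b s 0) (?w s 0)) - (s^3 / 6) *\<^sub>R (- A)"
      have X: "norm X \<le> \<epsilon> / 3 * s^3"
        unfolding X_def using elim by (intro spray_curve_Taylor(1)[OF \<phi> k sym h(1)]) auto
      have Y: "norm Y \<le> \<epsilon> / 3 * s^3"
        unfolding Y_def
      proof (rule spray_curve_Taylor(1)[OF \<phi> k sym h(2)])
        fix t assume "t \<in> {0..s}"
        then have t: "- t \<in> {-s..s}" by auto
        have "jerk \<phi> k (?b s t) (?w s t) - (- A) = - (jerk \<phi> k (c s (-t)) (v s (-t)) - A)"
          using rev(2)[OF in\<Omega>[OF t]] by simp
        then show "norm (jerk \<phi> k (?b s t) (?w s t) - (- A)) \<le> \<epsilon> / 3"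
          using elim(3) t by (simp only: norm_minus_cancel)
      qed (use elim in auto)
      define S where "S = c s s - c s (-s) - (2 * s) *\<^sub>R v s 0"
      have "S - (s^3 / 3) *\<^sub>R A = X - Y"
        using rev(1)[OF h(3), of "v s 0"] by (simp add: S_def X_def Y_def euclidean_eq_iff[where 'a='a] algebra_simps)
      then have "norm (S - (s^3 / 3) *\<^sub>R A) \<le> 2 * \<epsilon> / 3 * s^3"
        using norm_triangle_ineq4[of X Y] X Y by simp
      moreover have eq: "(1 / s^3) *\<^sub>R S - (1/3) *\<^sub>R A = (1 / s^3) *\<^sub>R (S - (s^3 / 3) *\<^sub>R A)"
        using elim(1) by (simp add: scaleR_diff_right)
      ultimately have "dist ((1 / s^3) *\<^sub>R S) ((1/3) *\<^sub>R A) \<le> 2 * \<epsilon> / 3"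
        unfolding dist_norm eq using elim(1) by (simp add: divide_simps mult.commute)
      then show ?case using \<open>\<epsilon> > 0\<close> unfolding S_def by linarith
    qed
  qed
  show "((\<lambda>s. (1 / s^4) *\<^sub>R (c s s + c s (-s) - 2 *\<^sub>R c s 0 - s^2 *\<^sub>R acc \<phi> k (c s 0) (v s 0)))
           \<longlongrightarrow> (1/12) *\<^sub>R snap \<phi> k x u) (at_right 0)"
  proof (rule tendstoI)
    fix \<epsilon> :: real assume "\<epsilon> > 0"
    define A where "A = snap \<phi> k x u"
    have "\<forall>\<^sub>F s in at_right 0. \<forall>\<tau>\<in>{-s..s}. norm (snap \<phi> k (c s \<tau>) (v s \<tau>) - A) \<le> \<epsilon> / 3"
      using near[OF spray_jets_near(2)[OF \<phi> k sym x, of "\<epsilon> / 3" u]] \<open>\<epsilon> > 0\<close> by (simp add: A_def)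
    with pos sc show "\<forall>\<^sub>F s in at_right 0. dist ((1 / s^4) *\<^sub>R (c s s + c s (-s) - 2 *\<^sub>R c s 0 - s^2 *\<^sub>R acc \<phi> k (c s 0) (v s 0))) ((1/12) *\<^sub>R A) < \<epsilon>"
    proof eventually_elim
      case (elim s)
      note h = halves[OF elim(2,1)]
      have in\<Omega>: "c s t \<in> \<Omega>" if "t \<in> {-s..s}" for t
        using elim(2) that by (auto simp: spray_curve_def)
      define X where "X = c s s - (c s 0 + s *\<^sub>R v s 0 + (s^2 / 2) *\<^sub>R acc \<phi> k (c s 0) (v s 0) 
         + (s^3 / 6) *\<^sub>R jerk \<phi> k (c s 0) (v s 0)) - (s^4 / 24) *\<^sub>R A"
      define Y where "Y = ?b s s - (?b s 0 + s *\<^sub>R ?w s 0 + (s^2 / 2) *\<^sub>R acc \<phi> k (?b s 0) (?w s 0) 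
         + (s^3 / 6) *\<^sub>R jerk \<phi> k (?b s 0) (?w s 0)) - (s^4 / 24) *\<^sub>R A"
      have X: "norm X \<le> \<epsilon> / 3 * s^4"
        unfolding X_def using elim by (intro spray_curve_Taylor(2)[OF \<phi> k sym h(1)]) auto
      have Y: "norm Y \<le> \<epsilon> / 3 * s^4"
        unfolding Y_def
      proof (rule spray_curve_Taylor(2)[OF \<phi> k sym h(2)])
        fix t assume "t \<in> {0..s}"
        then have t: "- t \<in> {-s..s}" by auto
        have "snap \<phi> k (?b s t) (?w s t) = snap \<phi> k (c s (-t)) (v s (-t))"
          using rev(3)[OF in\<Omega>[OF t]] by simp
        then show "norm (snap \<phi> k (?b s t) (?w s t) - A) \<le> \<epsilon> / 3"
          using elim(3) t by simp
      qed (use elim in auto)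
      define S where "S = c s s + c s (-s) - 2 *\<^sub>R c s 0 - s^2 *\<^sub>R acc \<phi> k (c s 0) (v s 0)"
      have "S - (s^4 / 12) *\<^sub>R A = X + Y"
        using rev(1,2)[OF h(3), of "v s 0"] by (simp add: S_def X_def Y_def euclidean_eq_iff[where 'a='a] algebra_simps)
      then have "norm (S - (s^4 / 12) *\<^sub>R A) \<le> 2 * \<epsilon> / 3 * s^4"
        using norm_triangle_ineq[of X Y] X Y by simp
      moreover have eq: "(1 / s^4) *\<^sub>R S - (1/12) *\<^sub>R A = (1 / s^4) *\<^sub>R (S - (s^4 / 12) *\<^sub>R A)"
        using elim(1) by (simp add: scaleR_diff_right)
      ultimately have "dist ((1 / s^4) *\<^sub>R S) ((1/12) *\<^sub>R A) \<le> 2 * \<epsilon> / 3"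
        unfolding dist_norm eq using elim(1) by (simp add: divide_simps mult.commute)
      then show ?case using \<open>\<epsilon> > 0\<close> unfolding S_def by linarith
    qed
  qed
qed

section \<open>The fourth-order obstruction\<close>

text \<open>
  Here \<^term>\<open>\<gamma>\<close> solves the equation for \<open>- k\<close> and \<^term>\<open>b s\<close> the one for \<^term>\<open>k\<close>.  With
  \<open>r = lim (b\<^sub>s(0) - x)/s\<^sup>2\<close> and \<open>p = lim (b\<^sub>s'(0) - u)/s\<^sup>2\<close>, the second differences of the
  two curves add up to zero, and dividing by \<open>s\<^sup>4\<close> equates the first-order variation of
  \<open>f k\<close> from \<open>(x, u)\<close> in direction \<open>(r, p)\<close> with minus a twelfth of the sum of the two fourth
  derivatives.  In that sum the Hessian of \<^term>\<open>f\<close> and the terms cubic in \<^term>\<open>k\<close> with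
  coefficient \<open>f\<^sup>3\<close> cancel, being odd under \<open>k \<mapsto> - k\<close>.
\<close>
lemma conjugate_midpoint_curves_obstruction:
  fixes k :: "'a::euclidean_space \<Rightarrow> 'a \<Rightarrow> 'a"
  assumes f: "smooth_on \<Omega> f" "open \<Omega>" and k: "bilinear k" and sym: "\<And>x y. k x y = k y x"
    and x: "x \<in> \<Omega>"
    and \<gamma>: "\<delta> > 0" "spray_curve \<Omega> f (\<lambda>x y. - k x y) {-\<delta>..\<delta>} \<gamma> \<gamma>'" "\<gamma> 0 = x" "\<gamma>' 0 = u"
    and b: "\<forall>\<^sub>F s in at_right 0. spray_curve \<Omega> f k {-s..s} (b s) (v s) \<and>
       b s s = \<gamma> s \<and> b s (-s) = \<gamma> (-s) \<and> b s 0 = \<gamma> s + \<gamma> (-s) - x"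
    and near: "\<And>P. \<forall>\<^sub>F p in nhds (x, u). P p \<Longrightarrow> \<forall>\<^sub>F s in at_right 0. \<forall>\<tau>\<in>{-s..s}. P (b s \<tau>, v s \<tau>)"
  shows "(5 * f x * frechet_derivative f (at x) (k u u)) *\<^sub>R k u u
       = (2 * f x * frechet_derivative f (at x) u) *\<^sub>R k u (k u u)"
proof -
  interpret k: bounded_bilinear k
    using k bilinear_conv_bounded_bilinear by blast
  let ?k = "\<lambda>x y. - k x y"
  let ?F = "at_right (0::real)"
  have k': "bilinear ?k"
    using k by (auto simp: bilinear_def linear_compose_neg)
  have sym': "?k y z = ?k z y" for y z
    by (simp add: sym)
  have pos: "\<forall>\<^sub>F s::real in ?F. s > 0"
    by (simp add: eventually_at_right_less)
  have small: "\<forall>\<^sub>F s::real in ?F. s < \<delta>"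
    using \<gamma>(1) by (simp add: eventually_at_right_field) blast
  have s0: "((\<lambda>s::real. s) \<longlongrightarrow> 0) ?F"
    by (rule tendsto_ident_at)
  have \<gamma>_sc: "\<forall>\<^sub>F s in ?F. spray_curve \<Omega> f ?k {-s..s} \<gamma> \<gamma>'"
    using small by eventually_elim (auto intro: spray_curve_subset[OF \<gamma>(2)])
  have \<gamma>_near: "\<forall>\<^sub>F s in ?F. \<forall>\<tau>\<in>{-s..s}. P (\<gamma> \<tau>, \<gamma>' \<tau>)" if P: "\<forall>\<^sub>F p in nhds (x, u). P p" for P
  proof -
    note spray_curve_continuous_on[OF \<gamma>(2)]
    then have "continuous_on {-\<delta>..\<delta>} (\<lambda>\<tau>. (\<gamma> \<tau>, \<gamma>' \<tau>))"
      by (intro continuous_on_Pair)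
    moreover have "0 \<in> interior {-\<delta>..\<delta>}"
      using \<gamma>(1) by simp
    ultimately have "isCont (\<lambda>\<tau>. (\<gamma> \<tau>, \<gamma>' \<tau>)) 0"
      by (rule continuous_on_interior)
    then have "((\<lambda>\<tau>. (\<gamma> \<tau>, \<gamma>' \<tau>)) \<longlongrightarrow> (x, u)) (nhds 0)"
      using tendsto_at_iff_tendsto_nhds[of "\<lambda>\<tau>. (\<gamma> \<tau>, \<gamma>' \<tau>)" 0] by (simp add: isCont_def \<gamma>(3,4))
    then have "\<forall>\<^sub>F \<tau> in nhds 0. P (\<gamma> \<tau>, \<gamma>' \<tau>)"
      using P by (rule eventually_compose_filterlim[rotated])
    then obtain e where e: "e > 0" "\<And>\<tau>. \<bar>\<tau>\<bar> < e \<Longrightarrow> P (\<gamma> \<tau>, \<gamma>' \<tau>)"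
      by (auto simp: eventually_nhds_metric dist_real_def)
    have "\<forall>\<^sub>F s::real in ?F. s < e"
      using e(1) by (simp add: eventually_at_right_field) blast
    then show ?thesis
      by eventually_elim (auto intro!: e(2))
  qed
  define D where "D w = frechet_derivative f (at x) w" for w
  define \<kappa> where "\<kappa> = k u u"
  note T\<gamma> = spray_second_difference[OF f k' sym' x \<gamma>_sc \<gamma>_near, unfolded \<gamma>(3,4)]
  have b_sc: "\<forall>\<^sub>F s in ?F. spray_curve \<Omega> f k {-s..s} (b s) (v s)"
    using b by eventually_elim simp
  note Tb = spray_second_difference[OF f k sym x b_sc near]
  define S where "S s = \<gamma> s + \<gamma> (-s) - 2 *\<^sub>R x" for s
  define r where "r = acc f ?k x u"
  define p where "p = (1/6) *\<^sub>R (jerk f ?k x u - jerk f k x u)"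
  have T2: "((\<lambda>s. (1 / s^4) *\<^sub>R (S s - s^2 *\<^sub>R r)) \<longlongrightarrow> (1/12) *\<^sub>R snap f ?k x u) ?F"
    using T\<gamma>(2) unfolding S_def r_def .
  have "((\<lambda>s. s^2 *\<^sub>R (1 / s^4) *\<^sub>R (S s - s^2 *\<^sub>R r) + r) \<longlongrightarrow> 0^2 *\<^sub>R (1/12) *\<^sub>R snap f ?k x u + r) ?F"
    by (intro tendsto_intros T2 s0)
  moreover have "\<forall>\<^sub>F s in ?F. s^2 *\<^sub>R (1 / s^4) *\<^sub>R (S s - s^2 *\<^sub>R r) + r = (1 / s^2) *\<^sub>R (b s 0 - x)"
    using pos b
  proof eventually_elim
    case (elim s)
    have "b s 0 - x = S s"
      using elim by (simp add: S_def scaleR_2)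
    then show ?case
      using elim(1) by (simp add: scaleR_diff_right power2_eq_square power4_eq_xxxx)
  qed
  ultimately have lim_r: "((\<lambda>s. (1 / s^2) *\<^sub>R (b s 0 - x)) \<longlongrightarrow> r) ?F"
    using Lim_transform_eventually by force
  have "((\<lambda>s. (1/2) *\<^sub>R ((1 / s^3) *\<^sub>R (\<gamma> s - \<gamma> (-s) - (2 * s) *\<^sub>R u) - (1 / s^3) *\<^sub>R (b s s - b s (-s) - (2 * s) *\<^sub>R v s 0)))
      \<longlongrightarrow> (1/2) *\<^sub>R ((1/3) *\<^sub>R jerk f ?k x u - (1/3) *\<^sub>R jerk f k x u)) ?F"
    by (intro tendsto_intros T\<gamma>(1) Tb(1))
  moreover have "\<forall>\<^sub>F s in ?F. (1/2) *\<^sub>R ((1 / s^3) *\<^sub>R (\<gamma> s - \<gamma> (-s) - (2 * s) *\<^sub>R u) - (1 / s^3) *\<^sub>R (b s s - b s (-s) - (2 * s) *\<^sub>R v s 0))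
     = (1 / s^2) *\<^sub>R (v s 0 - u)"
    using pos b
  proof eventually_elim
    case (elim s)
    have eq: "\<gamma> s - \<gamma> (-s) - (2 * s) *\<^sub>R u - (b s s - b s (-s) - (2 * s) *\<^sub>R v s 0) = (2 * s) *\<^sub>R (v s 0 - u)"
      using elim by (simp add: algebra_simps)
    show ?case
      unfolding scaleR_diff_right[of "1 / s^3", symmetric] eq
      using elim(1) by (simp add: power2_eq_square power3_eq_cube)
  qed
  ultimately have lim_p: "((\<lambda>s. (1 / s^2) *\<^sub>R (v s 0 - u)) \<longlongrightarrow> p) ?F"
    unfolding p_def using Lim_transform_eventually by (force simp: scaleR_diff_right)
  have bv: "((\<lambda>s. (b s 0, v s 0)) \<longlongrightarrow> (x, u)) ?F"
  proof (rule topological_tendstoI)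
    fix N assume "open N" "(x, u) \<in> N"
    then have "\<forall>\<^sub>F p in nhds (x, u). p \<in> N"
      using eventually_nhds by blast
    from near[OF this] pos show "\<forall>\<^sub>F s in ?F. (b s 0, v s 0) \<in> N"
      by eventually_elim auto
  qed
  have b_lim: "((\<lambda>s. b s 0) \<longlongrightarrow> x) ?F" and v_lim: "((\<lambda>s. v s 0) \<longlongrightarrow> u) ?F"
    using tendsto_fst[OF bv] tendsto_snd[OF bv] by simp_all
  have lim_f: "((\<lambda>s. (1 / s^2) *\<^sub>R (f (b s 0) - f x)) \<longlongrightarrow> D r) ?F"
    unfolding D_def by (rule difference_quotient_tendsto[OF smooth_on_has_derivative[OF f x] b_lim lim_r])
  have "((\<lambda>s. ((1 / s^2) *\<^sub>R (f (b s 0) - f x)) *\<^sub>R k (v s 0) (v s 0)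
      + f x *\<^sub>R (k ((1 / s^2) *\<^sub>R (v s 0 - u)) (v s 0) + k u ((1 / s^2) *\<^sub>R (v s 0 - u))))
     \<longlongrightarrow> D r *\<^sub>R k u u + f x *\<^sub>R (k p u + k u p)) ?F"
    by (intro tendsto_intros lim_f k.tendsto lim_p v_lim)
  moreover have "((1 / s^2) *\<^sub>R (f (b s 0) - f x)) *\<^sub>R k (v s 0) (v s 0)
      + f x *\<^sub>R (k ((1 / s^2) *\<^sub>R (v s 0 - u)) (v s 0) + k u ((1 / s^2) *\<^sub>R (v s 0 - u)))
     = (1 / s^2) *\<^sub>R (acc f k (b s 0) (v s 0) + r)" for s
    by (simp add: acc_def r_def k.scaleR_left k.scaleR_right k.diff_left k.diff_right
        diff_divide_distrib algebra_simps)
  ultimately have lim1: "((\<lambda>s. (1 / s^2) *\<^sub>R (acc f k (b s 0) (v s 0) + r)) \<longlongrightarrow> D r *\<^sub>R \<kappa> + f x *\<^sub>R (k p u + k u p)) ?F"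
    by (simp add: \<kappa>_def)
  have "((\<lambda>s. - ((1 / s^4) *\<^sub>R (S s - s^2 *\<^sub>R r) + (1 / s^4) *\<^sub>R (b s s + b s (-s) - 2 *\<^sub>R b s 0 - s^2 *\<^sub>R acc f k (b s 0) (v s 0))))
     \<longlongrightarrow> - ((1/12) *\<^sub>R snap f ?k x u + (1/12) *\<^sub>R snap f k x u)) ?F"
    by (intro tendsto_intros T2 Tb(2))
  moreover have "\<forall>\<^sub>F s in ?F. - ((1 / s^4) *\<^sub>R (S s - s^2 *\<^sub>R r) + (1 / s^4) *\<^sub>R (b s s + b s (-s) - 2 *\<^sub>R b s 0 - s^2 *\<^sub>R acc f k (b s 0) (v s 0)))
      = (1 / s^2) *\<^sub>R (acc f k (b s 0) (v s 0) + r)"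
    using pos b
  proof eventually_elim
    case (elim s)
    have "b s s + b s (-s) - 2 *\<^sub>R b s 0 = - S s"
      using elim by (simp add: S_def scaleR_2)
    then show ?case
      using elim(1) by (simp add: scaleR_diff_right scaleR_add_right power2_eq_square power4_eq_xxxx)
  qed
  ultimately have "((\<lambda>s. (1 / s^2) *\<^sub>R (acc f k (b s 0) (v s 0) + r)) \<longlongrightarrow>
      - ((1/12) *\<^sub>R snap f ?k x u + (1/12) *\<^sub>R snap f k x u)) ?F"
    by (rule Lim_transform_eventually)
  from tendsto_unique[OF _ lim1 this]
  have eq: "D r *\<^sub>R \<kappa> + f x *\<^sub>R (k p u + k u p) = - ((1/12) *\<^sub>R snap f ?k x u + (1/12) *\<^sub>R snap f k x u)"
    by simp
  \<comment> \<open>The limit identity is now evaluated in terms of \<open>\<kappa> = k u u\<close> and \<open>q = k u \<kappa>\<close>.\<close>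
  define q where "q = k u \<kappa>"
  note [simp] = frechet_derivative_linear[OF f x] k.scaleR_left k.scaleR_right k.minus_left k.minus_right
     k.add_right k.add_left k.diff_right
  have A: "acc f k x u = f x *\<^sub>R \<kappa>" "r = - (f x *\<^sub>R \<kappa>)" "acc f ?k x u = - (f x *\<^sub>R \<kappa>)"
    by (simp_all add: acc_def r_def \<kappa>_def)
  have J: "jerk f k x u = D u *\<^sub>R \<kappa> + (2 * f x * f x) *\<^sub>R q"
      "jerk f ?k x u = - (D u *\<^sub>R \<kappa>) + (2 * f x * f x) *\<^sub>R q"
    by (simp_all add: jerk_def A D_def q_def \<kappa>_def)
  have p: "p = - ((1/3) * D u) *\<^sub>R \<kappa>"
    unfolding p_def J by (simp add: euclidean_eq_iff[where 'a='a] inner_diff_left inner_add_left algebra_simps)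
  have "k u p = - ((1/3) * D u) *\<^sub>R q" "k p u = - ((1/3) * D u) *\<^sub>R q"
    by (simp_all add: p q_def sym[of \<kappa> u])
  moreover have "snap f k x u + snap f ?k x u = (2 * f x * D \<kappa>) *\<^sub>R \<kappa> + (12 * f x * D u) *\<^sub>R q"
    unfolding snap_def A J D_def[symmetric]
    by (simp add: euclidean_eq_iff[where 'a='a] inner_diff_left inner_add_left algebra_simps D_def
      flip: q_def \<kappa>_def)
  moreover have "D r = - (f x * D \<kappa>)"
    by (simp add: A D_def)
  ultimately have "- (f x * D \<kappa>) *\<^sub>R \<kappa> + f x *\<^sub>R (- ((1/3) * D u) *\<^sub>R q + - ((1/3) * D u) *\<^sub>R q)
     = - ((1/12) *\<^sub>R ((2 * f x * D \<kappa>) *\<^sub>R \<kappa> + (12 * f x * D u) *\<^sub>R q))"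
    using eq by (simp add: add.commute flip: scaleR_add_right)
  then show ?thesis
    unfolding \<kappa>_def[symmetric] q_def[symmetric] D_def[symmetric]
    by (simp add: euclidean_eq_iff[where 'a='a] inner_diff_left inner_add_left) (auto simp: field_simps)
qed

section \<open>Geodesics in a midpoint chart\<close>

context
  fixes \<Omega> :: "'a::euclidean_space set" and f :: "'a \<Rightarrow> real" and k :: "'a \<Rightarrow> 'a \<Rightarrow> 'a"
    and A :: "'a \<Rightarrow> 'a tensor12"
  assumes f: "smooth_on \<Omega> f" "open \<Omega>" and k: "bilinear k"
    and A: "\<forall>y\<in>\<Omega>. \<forall>X. A y X X = - (f y *\<^sub>R k X X)"
begin

lemma geodesic_iff_spray_curve:
  "geodesic \<Omega> A P v c \<longleftrightarrow> (\<exists>c'. c 0 = P \<and> c' 0 = v \<and> spray_curve \<Omega> f k {0..1} c c')"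
proof -
  have "(c t \<in> \<Omega> \<and> (c has_vector_derivative c' t) (at t within {0..1}) \<and>
        (\<exists>a. (c' has_vector_derivative a) (at t within {0..1}) \<and> a + A (c t) (c' t) (c' t) = 0))
     \<longleftrightarrow> (c t \<in> \<Omega> \<and> (c has_vector_derivative c' t) (at t within {0..1}) \<and>
        (c' has_vector_derivative f (c t) *\<^sub>R k (c' t) (c' t)) (at t within {0..1}))" for t c'
    using A by auto
  then show ?thesis
    unfolding geodesic_def spray_curve_def by simp
qed

lemma Exp_map_eq:
  assumes "spray_curve \<Omega> f k {0..1} c c'"
  shows "Exp_map \<Omega> A (c 0) (c' 0) = c 1"
  unfolding Exp_map_def
proof (rule the_equality)
  show "\<exists>d. geodesic \<Omega> A (c 0) (c' 0) d \<and> d 1 = c 1"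
    unfolding geodesic_iff_spray_curve using assms by blast
next
  fix Q assume "\<exists>d. geodesic \<Omega> A (c 0) (c' 0) d \<and> d 1 = Q"
  then obtain d d' where "d 1 = Q" "d 0 = c 0" "d' 0 = c' 0" "spray_curve \<Omega> f k {0..1} d d'"
    unfolding geodesic_iff_spray_curve by blast
  then show "Q = c 1"
    using spray_curve_unique[OF f k _ assms, of d d' 1] by simp
qed

lemma Exp_map_scaled:
  assumes c: "spray_curve \<Omega> f k {0..1} c c'" and t: "t \<in> {0..1}"
  shows "Exp_map \<Omega> A (c 0) (t *\<^sub>R c' 0) = c t"
proof -
  have "0 + t * r \<in> {0..1}" if "r \<in> {0..1}" for r
    using t that by (auto intro: mult_le_one)
  from Exp_map_eq[OF spray_curve_affine[OF k c this]] show ?thesis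
    by simp
qed

text \<open>
  The chart is injective, so a geodesic whose initial data lie in it is the one that the midpoint
  map selects for its end points.
\<close>
lemma midpoint_map_geodesic:
  assumes ch: "midpoint_chart \<Omega> A U W" and c: "spray_curve \<Omega> f k {0..1} c c'" and U: "(c 0, c' 0) \<in> U"
  shows "(c 0, c 1) \<in> W" "midpoint_map \<Omega> A U (c 0) (c 1) = c (1/2)"
proof -
  obtain G where G: "homeomorphism U W (exp_pair \<Omega> A) G"
    using ch by (auto simp: midpoint_chart_def diffeomorphic_via_def)
  have inj: "inj_on (exp_pair \<Omega> A) U"
    using homeomorphism_apply1[OF G] by (rule inj_on_inverseI)
  have E: "exp_pair \<Omega> A (c 0, c' 0) = (c 0, c 1)"
    by (simp add: exp_pair_def Exp_map_eq[OF c])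
  show "(c 0, c 1) \<in> W"
    using homeomorphism_image1[OF G] imageI[OF U, of "exp_pair \<Omega> A"] by (simp add: E)
  have "inv_into U (exp_pair \<Omega> A) (c 0, c 1) = (c 0, c' 0)"
    using inv_into_f_f[OF inj U] by (simp add: E)
  then show "midpoint_map \<Omega> A U (c 0) (c 1) = c (1/2)"
    using Exp_map_scaled[OF c, of "1/2"] by (simp add: midpoint_map_def)
qed

lemma chart_geodesic_exists:
  assumes ch: "midpoint_chart \<Omega> A U W" and U: "(P, v) \<in> U"
  obtains c c' where "spray_curve \<Omega> f k {0..1} c c'" "c 0 = P" "c' 0 = v"
  using assms unfolding midpoint_chart_def exp_domain_def geodesic_iff_spray_curve by blast

text \<open>
  A geodesic is \<open>t \<mapsto> Exp\<^sub>P(t w)\<close>, and the exponential map is Lipschitz near \<open>(x, 0)\<close>; this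
  bounds the speed by a multiple of \<open>|w|\<close>, and the quadratic equation then bounds the
  acceleration by a multiple of \<open>|w|\<^sup>2\<close>.
\<close>
lemma short_geodesics_nearly_straight:
  assumes ch: "midpoint_chart \<Omega> A U W" and x: "x \<in> \<Omega>"
  obtains \<delta> M where "\<delta> > 0" "M > 0"
    "\<And>c c' t. spray_curve \<Omega> f k {0..1} c c' \<Longrightarrow> norm (c 0 - x) < \<delta> \<Longrightarrow> norm (c' 0) < \<delta> \<Longrightarrow> t \<in> {0..1} \<Longrightarrow>
       norm (c t - c 0) \<le> M * norm (c' 0) \<and> norm (c' t - c' 0) \<le> M * (norm (c' 0))\<^sup>2"
proof -
  interpret k: bounded_bilinear k
    using k bilinear_conv_bounded_bilinear by blast
  obtain B where B: "B > 0" "\<And>x y. norm (k x y) \<le> norm x * norm y * B"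
    using k.pos_bounded by blast
  let ?E = "exp_pair \<Omega> A"
  have U: "open U" "smooth_on U ?E" "(x, 0) \<in> U"
    using ch x by (auto simp: midpoint_chart_def diffeomorphic_via_def)
  obtain r L where r: "r > 0" "L > 0" "cball (x, 0) r \<subseteq> U" "L-lipschitz_on (cball (x, 0) r) ?E"
    using smooth_on_locally_Lipschitz[OF U(2,1,3)] by metis
  obtain \<rho> where \<rho>: "\<rho> > 0" "cball x \<rho> \<subseteq> \<Omega>"
    using f(2) x by (meson open_contains_cball)
  have "bounded (f ` cball x \<rho>)"
    by (intro compact_imp_bounded compact_continuous_image continuous_on_subset[OF smooth_on_continuous_on[OF f(1)] \<rho>(2)]) simp
  then obtain F where F: "F > 0" "\<And>y. y \<in> cball x \<rho> \<Longrightarrow> \<bar>f y\<bar> \<le> F"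
    by (auto simp: bounded_pos)
  define \<delta> where "\<delta> = min (r / 2) (\<rho> / (L + 1))"
  define M where "M = L + F * L\<^sup>2 * B"
  have \<delta>0: "\<delta> > 0"
    using r(1,2) \<rho>(1) by (simp add: \<delta>_def)
  have M0: "M > 0"
    using r(2) F(1) B(1) by (simp add: M_def add_pos_pos)
  show ?thesis
  proof (rule that[OF \<delta>0 M0])
    fix c c' t assume c: "spray_curve \<Omega> f k {0..1} c c'" and P: "norm (c 0 - x) < \<delta>" and w: "norm (c' 0) < \<delta>"
      and t: "t \<in> {0..1::real}"
    let ?I = "{0..1::real}"
    define w where "w = c' 0"
    have E: "?E (c 0, s *\<^sub>R w) = (c 0, c s)" if "s \<in> ?I" for s
      using Exp_map_scaled[OF c that] by (simp add: exp_pair_def w_def)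
    have ball: "(c 0, s *\<^sub>R w) \<in> cball (x, 0) r" if "s \<in> ?I" for s
    proof -
      have "norm (c 0 - x, s *\<^sub>R w) \<le> norm (c 0 - x) + \<bar>s\<bar> * norm w"
        using norm_Pair_le[of "c 0 - x" "s *\<^sub>R w"] by simp
      also have "\<dots> \<le> \<delta> + 1 * \<delta>"
        using P w that by (intro add_mono mult_mono) (auto simp: w_def)
      also have "\<dots> \<le> r" by (simp add: \<delta>_def)
      finally have "norm (c 0 - x, s *\<^sub>R w) \<le> r" .
      moreover have "dist (x, 0) (c 0, s *\<^sub>R w) = norm (c 0 - x, s *\<^sub>R w)"
        by (subst dist_commute) (simp add: dist_norm)
      ultimately show ?thesis
        by simp
    qed
    have lip: "norm (c s - c s') \<le> (L * norm w) * \<bar>s - s'\<bar>" if s: "s \<in> ?I" "s' \<in> ?I" for s s'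
    proof -
      have "dist (?E (c 0, s *\<^sub>R w)) (?E (c 0, s' *\<^sub>R w)) \<le> L * dist (c 0, s *\<^sub>R w) (c 0, s' *\<^sub>R w)"
        using r(4) ball[OF s(1)] ball[OF s(2)] unfolding lipschitz_on_def by blast
      moreover have "dist (c 0, s *\<^sub>R w) (c 0, s' *\<^sub>R w) = \<bar>s - s'\<bar> * norm w"
        using scaleR_left_diff_distrib[of s s' w, symmetric] by (simp add: dist_Pair_Pair dist_norm)
      moreover have "dist (?E (c 0, s *\<^sub>R w)) (?E (c 0, s' *\<^sub>R w)) = norm (c s - c s')"
        by (simp only: E s dist_Pair_Pair) (simp add: dist_norm)
      ultimately show ?thesis
        by (simp add: mult_ac)
    qed
    have speed: "norm (c' s) \<le> L * norm w" if s: "s \<in> ?I" for s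
    proof (rule has_vector_derivative_norm_le)
      show "(c has_vector_derivative c' s) (at s within ?I)"
        using c s by (simp add: spray_curve_def)
      show "at s within ?I \<noteq> bot"
        using s by (simp add: trivial_limit_within)
    qed (use lip s in auto)
    have near: "norm (c s - c 0) \<le> L * norm w" if s: "s \<in> ?I" for s
    proof -
      have "norm (c s - c 0) \<le> L * norm w * \<bar>s\<bar>"
        using lip[OF s, of 0] by simp
      also have "\<dots> \<le> L * norm w * 1"
        using s r(2) by (intro mult_left_mono) auto
      finally show ?thesis by simp
    qed
    have accel: "norm (f (c s) *\<^sub>R k (c' s) (c' s)) \<le> F * L\<^sup>2 * B * (norm w)\<^sup>2" if s: "s \<in> ?I" for s
    proof -
      have "norm (c s - x) \<le> norm (c s - c 0) + norm (c 0 - x)"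
        using norm_triangle_ineq[of "c s - c 0" "c 0 - x"] by simp
      also have "\<dots> \<le> L * \<delta> + \<delta>"
        using near[OF s] P w r(2) by (intro add_mono order_trans[OF near[OF s]] mult_left_mono) (auto simp: w_def)
      also have "\<dots> = (L + 1) * \<delta>"
        by (simp add: algebra_simps)
      also have "\<dots> \<le> (L + 1) * (\<rho> / (L + 1))"
        using r(2) by (intro mult_left_mono) (auto simp: \<delta>_def)
      also have "\<dots> = \<rho>"
        using r(2) by simp
      finally have "\<bar>f (c s)\<bar> \<le> F"
        by (intro F(2)) (simp add: dist_norm norm_minus_commute)
      moreover have "norm (k (c' s) (c' s)) \<le> (L * norm w) * (L * norm w) * B"
        using speed[OF s] r(2) B(1) by (intro order_trans[OF B(2)] mult_mono) auto
      ultimately have "\<bar>f (c s)\<bar> * norm (k (c' s) (c' s)) \<le> F * ((L * norm w) * (L * norm w) * B)"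
        using F(1) by (intro mult_mono) auto
      then show ?thesis
        by (simp add: power2_eq_square mult_ac)
    qed
    have "norm (c' t - c' 0) \<le> (F * L\<^sup>2 * B * (norm w)\<^sup>2) * norm (t - 0)"
    proof (rule differentiable_bound[of ?I c' "\<lambda>s h. h *\<^sub>R (f (c s) *\<^sub>R k (c' s) (c' s))"])
      show "onorm (\<lambda>h. h *\<^sub>R (f (c s) *\<^sub>R k (c' s) (c' s))) \<le> F * L\<^sup>2 * B * (norm w)\<^sup>2" if "s \<in> ?I" for s
        by (rule onorm_scaleR_left_le[OF accel[OF that]])
    qed (use c t in \<open>auto simp: spray_curve_def has_vector_derivative_def\<close>)
    also have "\<dots> \<le> (F * L\<^sup>2 * B * (norm w)\<^sup>2) * 1"
      using t F(1) B(1) by (intro mult_left_mono) auto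
    also have "\<dots> \<le> M * (norm w)\<^sup>2"
      using r(2) by (simp add: M_def distrib_right)
    finally have "norm (c' t - c' 0) \<le> M * (norm w)\<^sup>2" .
    moreover have "norm (c t - c 0) \<le> M * norm w"
      by (rule order_trans[OF near[OF t]]) (use F(1) B(1) in \<open>simp add: M_def distrib_right\<close>)
    ultimately show "norm (c t - c 0) \<le> M * norm (c' 0) \<and> norm (c' t - c' 0) \<le> M * (norm (c' 0))\<^sup>2"
      by (simp add: w_def)
  qed
qed

end

section \<open>Midpoint invariance forces the obstruction to vanish\<close>

text \<open>
  The geodesic \<^term>\<open>g\<close> is used at an interior time, so that it extends to both sides of the
  point at which the obstruction is computed: its points at times \<open>t0 - s\<close> and \<open>t0 + s\<close> are
  the end points whose midpoints are compared.
\<close>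
lemma midpoint_invariance_along_geodesic:
  fixes k :: "'a::euclidean_space \<Rightarrow> 'a \<Rightarrow> 'a"
  assumes f: "smooth_on \<Omega> f" "open \<Omega>" and k: "bilinear k" and sym: "\<And>x y. k x y = k y x"
    and A: "\<forall>y\<in>\<Omega>. \<forall>X. A y X X = f y *\<^sub>R k X X"
    and A': "\<forall>y\<in>\<Omega>. \<forall>X. A' y X X = - (f y *\<^sub>R k X X)"
    and ch: "midpoint_chart \<Omega> A U W" and ch': "midpoint_chart \<Omega> A' U' W'"
    and N: "open N" "diagonal \<Omega> \<subseteq> N" "N \<subseteq> W \<inter> W'"
    and mid: "\<And>P Q. (P, Q) \<in> N \<Longrightarrow> midpoint_map \<Omega> A U P Q + midpoint_map \<Omega> A' U' P Q = P + Q"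
    and g: "spray_curve \<Omega> f (\<lambda>x y. - k x y) {0..1} g g'" and t0: "0 < t0" "t0 < 1"
  shows "(5 * f (g t0) * frechet_derivative f (at (g t0)) (k (g' t0) (g' t0))) *\<^sub>R k (g' t0) (g' t0)
       = (2 * f (g t0) * frechet_derivative f (at (g t0)) (g' t0)) *\<^sub>R k (g' t0) (k (g' t0) (g' t0))"
proof -
  let ?k = "\<lambda>x y. - k x y"
  let ?F = "at_right (0::real)"
  have k': "bilinear ?k"
    using k by (auto simp: bilinear_def linear_compose_neg)
  have A_k: "\<forall>y\<in>\<Omega>. \<forall>X. A y X X = - (f y *\<^sub>R ?k X X)"
    using A by simp
  note mid_g = midpoint_map_geodesic[where \<Omega>=\<Omega> and f=f and k="?k" and A=A, OF f k' A_k]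
  note Exp' = Exp_map_eq[where \<Omega>=\<Omega> and f=f and k=k and A=A', OF f k A']
    and Exp_scaled' = Exp_map_scaled[where \<Omega>=\<Omega> and f=f and k=k and A=A', OF f k A']
    and mid_g' = midpoint_map_geodesic[where \<Omega>=\<Omega> and f=f and k=k and A=A', OF f k A']
    and chart_geo' = chart_geodesic_exists[where \<Omega>=\<Omega> and f=f and k=k and A=A', OF f k A']
    and short' = short_geodesics_nearly_straight[where \<Omega>=\<Omega> and f=f and k=k and A=A', OF f k A']
  define x u where "x = g t0" and "u = g' t0"
  have x: "x \<in> \<Omega>"
    using g t0 by (simp add: spray_curve_def x_def)
  define \<delta> where "\<delta> = min t0 (1 - t0)"
  have \<delta>: "\<delta> > 0" "\<And>s. s \<in> {-\<delta>..\<delta>} \<Longrightarrow> t0 + s \<in> {0..1}"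
    using t0 by (auto simp: \<delta>_def)
  have pos: "\<forall>\<^sub>F s::real in ?F. s > 0"
    by (simp add: eventually_at_right_less)
  have small: "\<forall>\<^sub>F s::real in ?F. s < \<delta>"
    using \<delta>(1) by (simp add: eventually_at_right_field) blast
  have s0: "((\<lambda>s::real. s) \<longlongrightarrow> 0) ?F"
    by (rule tendsto_ident_at)
  have int: "t0 \<in> interior {0..1}"
    using t0 by simp
  have g_cont: "isCont g t0" "isCont g' t0"
    using spray_curve_continuous_on[OF g] continuous_on_interior[OF _ int] by blast+
  have tp: "((\<lambda>s. t0 + s) \<longlongrightarrow> t0) ?F" and tm: "((\<lambda>s. t0 - s) \<longlongrightarrow> t0) ?F"
    using tendsto_add[OF tendsto_const[of t0] s0] tendsto_diff[OF tendsto_const[of t0] s0] by simp_all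
  have gp: "((\<lambda>s. g (t0 + s)) \<longlongrightarrow> x) ?F" and gm: "((\<lambda>s. g (t0 - s)) \<longlongrightarrow> x) ?F"
    and g'm: "((\<lambda>s. g' (t0 - s)) \<longlongrightarrow> u) ?F"
    unfolding x_def u_def
    by (rule isCont_tendsto_compose[OF g_cont(1) tp] isCont_tendsto_compose[OF g_cont(1) tm]
        isCont_tendsto_compose[OF g_cont(2) tm])+
  have g_deriv: "(g has_vector_derivative u) (at t0)"
  proof -
    have "(g has_vector_derivative g' t0) (at t0 within {0..1})"
      using g t0 by (simp add: spray_curve_def)
    then show ?thesis
      using t0 by (simp add: u_def at_within_Icc_at)
  qed
  obtain G where G: "homeomorphism U' W' (exp_pair \<Omega> A') G"
    using ch' by (auto simp: midpoint_chart_def diffeomorphic_via_def)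
  have open_U: "open U" "(x, 0) \<in> U" and W': "open W'" "(x, x) \<in> W'" and U': "(x, 0) \<in> U'"
    using ch ch' x by (auto simp: midpoint_chart_def diffeomorphic_via_def diagonal_def)
  have xxN: "(x, x) \<in> N"
    using N(2) x by (auto simp: diagonal_def)
  have "((\<lambda>s. (g (t0 - s), (2 * s) *\<^sub>R g' (t0 - s))) \<longlongrightarrow> (x, (2 * 0) *\<^sub>R u)) ?F"
    by (intro tendsto_intros gm g'm s0)
  then have inU: "\<forall>\<^sub>F s in ?F. (g (t0 - s), (2 * s) *\<^sub>R g' (t0 - s)) \<in> U"
    using open_U by (auto dest: topological_tendstoD)
  have PQ: "((\<lambda>s. (g (t0 - s), g (t0 + s))) \<longlongrightarrow> (x, x)) ?F"
    by (intro tendsto_intros gm gp)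
  then have inN: "\<forall>\<^sub>F s in ?F. (g (t0 - s), g (t0 + s)) \<in> N"
    using N(1) xxN by (auto dest: topological_tendstoD)
  have "\<forall>\<^sub>F s in ?F. \<exists>cv. spray_curve \<Omega> f k {0..1} (fst cv) (snd cv) \<and>
      fst cv 0 = g (t0 - s) \<and> fst cv 1 = g (t0 + s) \<and>
      G (g (t0 - s), g (t0 + s)) = (g (t0 - s), snd cv 0) \<and>
      fst cv (1/2) = g (t0 + s) + g (t0 - s) - x"
    using pos small inU inN
  proof eventually_elim
    case (elim s)
    define P Q where "P = g (t0 - s)" and "Q = g (t0 + s)"
    have "(t0 - s) + (2 * s) * t \<in> {0..1}" if "t \<in> {0..1}" for t
    proof -
      have "s * t \<le> s" "0 \<le> s * t"
        using that elim(1) by (auto intro: mult_left_le)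
      then have "- s + 2 * (s * t) \<in> {-\<delta>..\<delta>}"
        using elim(1,2) unfolding atLeastAtMost_iff by linarith
      from \<delta>(2)[OF this] show ?thesis by (simp add: algebra_simps)
    qed
    then have "spray_curve \<Omega> f ?k {0..1} (\<lambda>t. g (t0 - s + 2 * s * t)) (\<lambda>t. (2 * s) *\<^sub>R g' (t0 - s + 2 * s * t))"
      by (rule spray_curve_affine[OF k' g])
    from mid_g(2)[OF ch this] elim(3)
    have M: "midpoint_map \<Omega> A U P Q = x"
      by (simp add: P_def Q_def x_def add.commute)
    have "(P, Q) \<in> W'"
      using elim(4) N(3) by (auto simp: P_def Q_def)
    then have GU: "G (P, Q) \<in> U'" and EG: "exp_pair \<Omega> A' (G (P, Q)) = (P, Q)"
      using G homeomorphism_image2[OF G] homeomorphism_apply2[OF G] by blast+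
    obtain w where w: "G (P, Q) = (P, w)"
      using EG by (cases "G (P, Q)") (auto simp: exp_pair_def)
    obtain c v where c: "spray_curve \<Omega> f k {0..1} c v" "c 0 = P" "v 0 = w"
      using chart_geo'[OF ch' GU[unfolded w]] by blast
    have c1: "c 1 = Q"
      using Exp'[OF c(1)] EG by (simp add: w exp_pair_def c)
    have "midpoint_map \<Omega> A' U' P Q = c (1/2)"
      using mid_g'(2)[OF ch' c(1)] GU by (simp add: c c1 w)
    then have "c (1/2) = Q + P - x"
      using mid[of P Q] M elim(4) by (simp add: P_def Q_def algebra_simps)
    then show ?case
      using c c1 w by (intro exI[of _ "(c, v)"]) (simp add: P_def Q_def)
  qed
  then obtain CV where CV: "\<forall>\<^sub>F s in ?F. spray_curve \<Omega> f k {0..1} (fst (CV s)) (snd (CV s)) \<and>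
      fst (CV s) 0 = g (t0 - s) \<and> fst (CV s) 1 = g (t0 + s) \<and>
      G (g (t0 - s), g (t0 + s)) = (g (t0 - s), snd (CV s) 0) \<and>
      fst (CV s) (1/2) = g (t0 + s) + g (t0 - s) - x"
    unfolding eventually_ex by blast
  define c v w where "c s = fst (CV s)" and "v s = snd (CV s)" and "w s = snd (CV s) 0" for s
  have cv: "\<forall>\<^sub>F s in ?F. spray_curve \<Omega> f k {0..1} (c s) (v s) \<and>
      c s 0 = g (t0 - s) \<and> c s 1 = g (t0 + s) \<and> v s 0 = w s \<and>
      G (g (t0 - s), g (t0 + s)) = (g (t0 - s), w s) \<and> c s (1/2) = g (t0 + s) + g (t0 - s) - x"
    using CV by (simp add: c_def v_def w_def)
  \<comment> \<open>Continuity of the inverse of the chart makes the connecting geodesics short.\<close>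
  have w_lim: "(w \<longlongrightarrow> 0) ?F"
  proof -
    obtain c v where "spray_curve \<Omega> f k {0..1} c v" "c 0 = x" "v 0 = 0"
      using chart_geo'[OF ch' U'] by blast
    then have "exp_pair \<Omega> A' (x, 0) = (x, x)"
      using Exp_scaled'[of c v 0] Exp'[of c v] by (simp add: exp_pair_def)
    then have Gxx: "G (x, x) = (x, 0)"
      using homeomorphism_apply1[OF G U'] by simp
    have "isCont G (x, x)"
      using homeomorphism_cont2[OF G] W' continuous_on_eq_continuous_at by blast
    from isCont_tendsto_compose[OF this PQ]
    have "((\<lambda>s. snd (G (g (t0 - s), g (t0 + s)))) \<longlongrightarrow> snd (x, 0::'a)) ?F"
      unfolding Gxx by (rule tendsto_snd)
    then have "((\<lambda>s. snd (G (g (t0 - s), g (t0 + s)))) \<longlongrightarrow> 0) ?F"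
      by simp
    then show ?thesis
      by (rule Lim_transform_eventually) (use cv in eventually_elim, simp)
  qed
  obtain d M where dM: "d > 0" "M > 0"
    "\<And>c c' t. spray_curve \<Omega> f k {0..1} c c' \<Longrightarrow> norm (c 0 - x) < d \<Longrightarrow> norm (c' 0) < d \<Longrightarrow> t \<in> {0..1} \<Longrightarrow>
       norm (c t - c 0) \<le> M * norm (c' 0) \<and> norm (c' t - c' 0) \<le> M * (norm (c' 0))\<^sup>2"
    using short'[OF ch' x] by blast
  have "\<forall>\<^sub>F s in ?F. norm (g (t0 - s) - x) < d"
    using tendstoD[OF gm dM(1)] by (simp add: dist_norm)
  moreover have "\<forall>\<^sub>F s in ?F. norm (w s) < d"
    using tendstoD[OF w_lim dM(1)] by simp
  ultimately have straight: "\<forall>\<^sub>F s in ?F. \<forall>t\<in>{0..1}. norm (c s t - c s 0) \<le> M * norm (w s) \<and> norm (v s t - w s) \<le> M * (norm (w s))\<^sup>2"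
    using cv
  proof eventually_elim
    case (elim s)
    then show ?case using dM(3)[of "c s" "v s"] by auto
  qed
  define q where "q s = g (t0 + s) - g (t0 - s)" for s
  have q_lim: "((\<lambda>s. (1 / (2 * s)) *\<^sub>R q s) \<longlongrightarrow> u) ?F"
  proof -
    have d: "(g has_derivative (\<lambda>h. h *\<^sub>R u)) (at t0)"
      using g_deriv by (simp add: has_vector_derivative_def)
    have "((\<lambda>s. (1 / s) *\<^sub>R (t0 + s - t0)) \<longlongrightarrow> 1) ?F" "((\<lambda>s. (1 / s) *\<^sub>R (t0 - s - t0)) \<longlongrightarrow> - 1) ?F"
      by (rule tendsto_eventually, use pos in eventually_elim, simp)+
    from tendsto_diff[OF difference_quotient_tendsto[OF d tp this(1)] difference_quotient_tendsto[OF d tm this(2)]]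
    have "((\<lambda>s. (1/2) *\<^sub>R ((1 / s) *\<^sub>R (g (t0 + s) - g t0) - (1 / s) *\<^sub>R (g (t0 - s) - g t0)))
       \<longlongrightarrow> (1/2) *\<^sub>R (1 *\<^sub>R u - (- 1) *\<^sub>R u)) ?F"
      by (intro tendsto_scaleR tendsto_const)
    moreover have "(1/2) *\<^sub>R (1 *\<^sub>R u - (- 1) *\<^sub>R u) = u"
      by (simp flip: scaleR_2)
    moreover have "(1/2) *\<^sub>R ((1 / s) *\<^sub>R (g (t0 + s) - g t0) - (1 / s) *\<^sub>R (g (t0 - s) - g t0)) = (1 / (2 * s)) *\<^sub>R q s" for s
      by (simp add: q_def scaleR_diff_right)
    ultimately show ?thesis by simp
  qed
  have chord: "\<forall>\<^sub>F s in ?F. norm (q s - w s) \<le> M * (norm (w s))\<^sup>2"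
    using straight cv
  proof eventually_elim
    case (elim s)
    have "norm ((c s 1 - 1 *\<^sub>R w s) - (c s 0 - 0 *\<^sub>R w s)) \<le> M * (norm (w s))\<^sup>2 * norm (1 - 0 :: real)"
    proof (rule differentiable_bound[of "{0..1}" "\<lambda>t. c s t - t *\<^sub>R w s" "\<lambda>t h. h *\<^sub>R (v s t - w s)"])
      fix t :: real assume t: "t \<in> {0..1}"
      have "((\<lambda>t. c s t - t *\<^sub>R w s) has_vector_derivative v s t - w s) (at t within {0..1})"
        using elim(2) t by (auto simp: spray_curve_def intro!: derivative_eq_intros)
      then show "((\<lambda>t. c s t - t *\<^sub>R w s) has_derivative (\<lambda>h. h *\<^sub>R (v s t - w s))) (at t within {0..1})"
        by (simp add: has_vector_derivative_def)
      show "onorm (\<lambda>h. h *\<^sub>R (v s t - w s)) \<le> M * (norm (w s))\<^sup>2"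
        using elim(1) t by (intro onorm_scaleR_left_le) blast
    qed auto
    then show ?case
      using elim(2) by (simp add: q_def algebra_simps)
  qed
  have Mw: "((\<lambda>s. M * norm (w s)) \<longlongrightarrow> 0) ?F"
    using tendsto_mult[OF tendsto_const[of M] tendsto_norm[OF w_lim]] by simp
  \<comment> \<open>The chord is the initial velocity up to a quadratic error, which is absorbed once
    \<open>M |w s| < 1/2\<close>; so the rescaled velocity inherits the limit of the rescaled chord.\<close>
  have wq: "((\<lambda>s. (1 / (2 * s)) *\<^sub>R w s) \<longlongrightarrow> u) ?F"
  proof -
    have "\<forall>\<^sub>F s in ?F. M * norm (w s) < 1 / 2"
      by (rule order_tendstoD(2)[OF Mw]) simp
    with chord pos have "\<forall>\<^sub>F s in ?F. norm ((1 / (2 * s)) *\<^sub>R (q s - w s)) \<le> (M * norm (w s)) * (2 * norm ((1 / (2 * s)) *\<^sub>R q s))"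
    proof eventually_elim
      case (elim s)
      have "norm (q s - w s) \<le> (M * norm (w s)) * norm (w s)"
        using elim(1) by (simp add: power2_eq_square mult_ac)
      moreover have "(M * norm (w s)) * norm (w s) \<le> 1 / 2 * norm (w s)"
        using elim(3) by (intro mult_right_mono) auto
      ultimately have "norm (w s) \<le> 2 * norm (q s)"
        using norm_triangle_sub[of "w s" "q s"] by (simp add: norm_minus_commute)
      then have "norm (q s - w s) \<le> (M * norm (w s)) * (2 * norm (q s))"
        using dM(2) by (intro order_trans[OF \<open>norm (q s - w s) \<le> (M * norm (w s)) * norm (w s)\<close>] mult_left_mono) simp_all
      then show ?case
        using elim(2) by (simp add: divide_simps mult_ac)
    qed
    moreover have "((\<lambda>s. (M * norm (w s)) * (2 * norm ((1 / (2 * s)) *\<^sub>R q s))) \<longlongrightarrow> 0) ?F"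
      using tendsto_mult[OF Mw tendsto_mult[OF tendsto_const[of 2] tendsto_norm[OF q_lim]]] by simp
    ultimately have "((\<lambda>s. (1 / (2 * s)) *\<^sub>R (q s - w s)) \<longlongrightarrow> 0) ?F"
      by (rule Lim_null_comparison)
    from tendsto_diff[OF q_lim this] show ?thesis
      by (simp add: scaleR_diff_right)
  qed
  \<comment> \<open>The connecting geodesics, reparametrized from \<open>[0, 1]\<close> to \<open>[-s, s]\<close> like the arcs of \<open>g\<close>.\<close>
  define b where "b s \<tau> = c s (1/2 + (1 / (2 * s)) * \<tau>)" for s \<tau>
  define y where "y s \<tau> = (1 / (2 * s)) *\<^sub>R v s (1/2 + (1 / (2 * s)) * \<tau>)" for s \<tau>
  have unit: "1/2 + (1 / (2 * s)) * \<tau> \<in> {0..1}" if "s > 0" "\<tau> \<in> {-s..s}" for s \<tau> :: real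
    using that by (auto simp: field_simps)
  show ?thesis
    unfolding x_def[symmetric] u_def[symmetric]
  proof (rule conjugate_midpoint_curves_obstruction[OF f k sym x, of \<delta> "\<lambda>s. g (t0 + 1 * s)" "\<lambda>s. 1 *\<^sub>R g' (t0 + 1 * s)" u b y])
    show "\<delta> > 0" by (rule \<delta>(1))
    show "spray_curve \<Omega> f ?k {-\<delta>..\<delta>} (\<lambda>s. g (t0 + 1 * s)) (\<lambda>s. 1 *\<^sub>R g' (t0 + 1 * s))"
      by (rule spray_curve_affine[OF k' g]) (use \<delta>(2) in simp)
    show "g (t0 + 1 * 0) = x" "1 *\<^sub>R g' (t0 + 1 * 0) = u"
      by (simp_all add: x_def u_def)
    show "\<forall>\<^sub>F s in ?F. spray_curve \<Omega> f k {-s..s} (b s) (y s) \<and>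
       b s s = g (t0 + 1 * s) \<and> b s (-s) = g (t0 + 1 * -s) \<and> b s 0 = g (t0 + 1 * s) + g (t0 + 1 * -s) - x"
      using pos cv
    proof eventually_elim
      case (elim s)
      have "spray_curve \<Omega> f k {-s..s} (b s) (y s)"
        unfolding b_def[abs_def] y_def[abs_def]
        by (rule spray_curve_affine[OF k conjunct1[OF elim(2)] unit[OF elim(1)]])
      then show ?case
        using elim by (simp add: b_def)
    qed
    fix P assume P: "\<forall>\<^sub>F p in nhds (x, u). P p"
    then obtain e where e: "e > 0" "\<And>p. dist p (x, u) < e \<Longrightarrow> P p"
      by (auto simp: eventually_nhds_metric)
    \<comment> \<open>A common bound for the distance of the whole curve and its velocity from \<open>(x, u)\<close>.\<close>
    define \<eta> where "\<eta> s = (M * norm (w s) + norm (g (t0 - s) - x)) + (M * norm (w s) * norm ((1 / (2 * s)) *\<^sub>R w s) + norm ((1 / (2 * s)) *\<^sub>R w s - u))" for s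
    have "(\<eta> \<longlongrightarrow> (0 + norm (x - x)) + (0 * norm u + norm (u - u))) ?F"
      unfolding \<eta>_def by (intro tendsto_intros Mw gm wq)
    then have "\<forall>\<^sub>F s in ?F. \<eta> s < e"
      using e(1) order_tendstoD(2)[of \<eta> 0] by simp
    with pos straight cv show "\<forall>\<^sub>F s in ?F. \<forall>\<tau>\<in>{-s..s}. P (b s \<tau>, y s \<tau>)"
    proof eventually_elim
      case (elim s)
      show ?case
      proof
        fix \<tau> assume "\<tau> \<in> {-s..s}"
        define t where "t = 1/2 + (1 / (2 * s)) * \<tau>"
        have t: "t \<in> {0..1}"
          unfolding t_def by (rule unit) fact+
        have "norm (b s \<tau> - x) \<le> norm (c s t - c s 0) + norm (c s 0 - x)"
          using norm_triangle_ineq[of "c s t - c s 0" "c s 0 - x"] by (simp add: b_def t_def)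
        also have "\<dots> \<le> M * norm (w s) + norm (g (t0 - s) - x)"
          using elim(2,3) t by simp
        finally have 1: "norm (b s \<tau> - x) \<le> M * norm (w s) + norm (g (t0 - s) - x)" .
        have "norm ((1 / (2 * s)) *\<^sub>R (v s t - w s)) \<le> (1 / (2 * s)) * (M * (norm (w s))\<^sup>2)"
          using elim(1,2) t by (simp add: divide_right_mono)
        also have "\<dots> = M * norm (w s) * norm ((1 / (2 * s)) *\<^sub>R w s)"
          using elim(1) by (simp add: power2_eq_square)
        finally have small_v: "norm ((1 / (2 * s)) *\<^sub>R (v s t - w s)) \<le> M * norm (w s) * norm ((1 / (2 * s)) *\<^sub>R w s)" .
        have y_eq: "y s \<tau> - u = (1 / (2 * s)) *\<^sub>R (v s t - w s) + ((1 / (2 * s)) *\<^sub>R w s - u)"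
          by (simp add: y_def t_def scaleR_diff_right)
        have 2: "norm (y s \<tau> - u) \<le> M * norm (w s) * norm ((1 / (2 * s)) *\<^sub>R w s) + norm ((1 / (2 * s)) *\<^sub>R w s - u)"
          unfolding y_eq by (rule norm_triangle_mono[OF small_v order_refl])
        have "dist (b s \<tau>, y s \<tau>) (x, u) \<le> norm (b s \<tau> - x) + norm (y s \<tau> - u)"
          using norm_Pair_le[of "b s \<tau> - x" "y s \<tau> - u"] by (simp add: dist_norm)
        also have "\<dots> \<le> \<eta> s"
          using 1 2 by (simp add: \<eta>_def)
        finally show "P (b s \<tau>, y s \<tau>)"
          using elim(4) by (intro e(2)) simp
      qed
    qed
  qed
qed

text \<open>
  Every point is the start of a geodesic with a small multiple of the given velocity.  The identity
  holds at its interior times, hence in the limit at time 0, and both sides are homogeneous of degree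
  four in the velocity.
\<close>
lemma midpoint_invariance_obstruction:
  fixes k :: "'a::euclidean_space \<Rightarrow> 'a \<Rightarrow> 'a"
  assumes f: "smooth_on \<Omega> f" "open \<Omega>" and k: "bilinear k" and sym: "\<And>x y. k x y = k y x"
    and A: "\<forall>y\<in>\<Omega>. \<forall>X. A y X X = f y *\<^sub>R k X X"
    and A': "\<forall>y\<in>\<Omega>. \<forall>X. A' y X X = - (f y *\<^sub>R k X X)"
    and ch: "midpoint_chart \<Omega> A U W" and ch': "midpoint_chart \<Omega> A' U' W'"
    and N: "open N" "diagonal \<Omega> \<subseteq> N" "N \<subseteq> W \<inter> W'"
    and mid: "\<And>P Q. (P, Q) \<in> N \<Longrightarrow> midpoint_map \<Omega> A U P Q + midpoint_map \<Omega> A' U' P Q = P + Q"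
    and x: "x \<in> \<Omega>"
  shows "(5 * f x * frechet_derivative f (at x) (k u u)) *\<^sub>R k u u
       = (2 * f x * frechet_derivative f (at x) u) *\<^sub>R k u (k u u)"
proof -
  interpret k: bounded_bilinear k
    using k bilinear_conv_bounded_bilinear by blast
  let ?k = "\<lambda>x y. - k x y"
  let ?F = "at_right (0::real)"
  have k': "bilinear ?k"
    using k by (auto simp: bilinear_def linear_compose_neg)
  have A_k: "\<forall>y\<in>\<Omega>. \<forall>X. A y X X = - (f y *\<^sub>R ?k X X)"
    using A by simp
  define lhs rhs where "lhs y w = (5 * f y * frechet_derivative f (at y) (k w w)) *\<^sub>R k w w"
    and "rhs y w = (2 * f y * frechet_derivative f (at y) w) *\<^sub>R k w (k w w)" for y w
  have openU: "open U" "(x, 0) \<in> U"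
    using ch x by (auto simp: midpoint_chart_def diffeomorphic_via_def)
  have "((\<lambda>r. (x, r *\<^sub>R u)) \<longlongrightarrow> (x, 0 *\<^sub>R u)) ?F"
    by (intro tendsto_intros)
  then have "\<forall>\<^sub>F r in ?F. (x, r *\<^sub>R u) \<in> U"
    using openU by (auto dest: topological_tendstoD)
  moreover have "\<forall>\<^sub>F r::real in ?F. r > 0"
    by (simp add: eventually_at_right_less)
  ultimately have "\<forall>\<^sub>F r in ?F. (x, r *\<^sub>R u) \<in> U \<and> r > 0"
    by (rule eventually_conj)
  then obtain r where r: "(x, r *\<^sub>R u) \<in> U" "r > 0"
    using eventually_happens'[of ?F] by force
  obtain g g' where g: "spray_curve \<Omega> f ?k {0..1} g g'" "g 0 = x" "g' 0 = r *\<^sub>R u"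
    using chart_geodesic_exists[OF f k' A_k ch r(1)] by blast
  have in01: "\<forall>\<^sub>F t::real in ?F. 0 < t \<and> t < 1"
    by (auto simp: eventually_at_right_field intro: exI[of _ 1])
  have ev: "\<forall>\<^sub>F t in ?F. lhs (g t) (g' t) = rhs (g t) (g' t)"
    using in01
  proof eventually_elim
    case (elim t)
    then show ?case
      unfolding lhs_def rhs_def
      using midpoint_invariance_along_geodesic[OF f k sym A A' ch ch' N mid g(1)] by blast
  qed
  have "continuous_on {0..1} g" "continuous_on {0..1} g'"
    using spray_curve_continuous_on[OF g(1)] by auto
  then have gt: "(g \<longlongrightarrow> x) ?F" and g't: "(g' \<longlongrightarrow> r *\<^sub>R u) ?F"
    unfolding g(2,3)[symmetric] by (auto intro!: continuous_on_Icc_at_rightD)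
  have lims: "((\<lambda>t. lhs (g t) (g' t)) \<longlongrightarrow> lhs x (r *\<^sub>R u)) ?F" "((\<lambda>t. rhs (g t) (g' t)) \<longlongrightarrow> rhs x (r *\<^sub>R u)) ?F"
    unfolding lhs_def rhs_def
    by (intro tendsto_intros k.tendsto gt g't smooth_on_tendsto[OF f x] frechet_derivative_tendsto[OF f x])+
  have "lhs x (r *\<^sub>R u) = rhs x (r *\<^sub>R u)"
    by (rule tendsto_unique[OF _ Lim_transform_eventually[OF lims(1) ev] lims(2)]) simp
  then have "r^4 *\<^sub>R lhs x u = r^4 *\<^sub>R rhs x u"
    by (simp add: lhs_def rhs_def k.scaleR_left k.scaleR_right frechet_derivative_linear[OF f x] power4_eq_xxxx mult_ac)
  then have "lhs x u = rhs x u"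
    by (rule scaleR_left_imp_eq[rotated]) (use r(2) in simp)
  then show ?thesis
    by (simp add: lhs_def rhs_def)
qed

section \<open>Vanishing of the obstruction forces constancy\<close>

text \<open>
  Evaluating at \<open>\<plusminus>1\<close> and \<open>\<plusminus>2\<close> suffices, since the constant term is absent.
\<close>
lemma quartic_polynomial_zero_coeffs:
  fixes c1 c2 c3 c4 :: "'a::euclidean_space"
  assumes "\<And>t::real. t *\<^sub>R c1 + t^2 *\<^sub>R c2 + t^3 *\<^sub>R c3 + t^4 *\<^sub>R c4 = 0"
  shows "c1 = 0" "c2 = 0"
proof -
  have eq: "t * (c1 \<bullet> b) + t^2 * (c2 \<bullet> b) + t^3 * (c3 \<bullet> b) + t^4 * (c4 \<bullet> b) = 0" for t b
    using arg_cong[OF assms[of t], of "\<lambda>z. z \<bullet> b"] by (simp add: inner_add_left)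
  have "c1 \<bullet> b = 0 \<and> c2 \<bullet> b = 0" for b
    using eq[of 1 b] eq[of "-1" b] eq[of 2 b] eq[of "-2" b] by simp
  then show "c1 = 0" "c2 = 0"
    by (simp_all add: euclidean_eq_iff[where 'a='a])
qed

text \<open>
  The identity is expanded at \<open>h = e + t v\<close>.  Order 0 gives \<open>l e = 0\<close>, order 1 gives
  \<open>l (k e v) = (\<mu>/5) l v\<close>, and applying \<^term>\<open>l\<close> to order 2 leaves
  \<open>(6/25) \<mu>\<^sup>2 (l v)\<^sup>2 = 0\<close>: the terms with \<open>l e\<close> vanish, and order 1 turns the
  others into multiples of \<open>(l v)\<^sup>2\<close>.
\<close>
lemma quartic_identity_forces_zero:
  fixes k :: "'a::euclidean_space \<Rightarrow> 'a \<Rightarrow> 'a" and l :: "'a \<Rightarrow> real"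
  assumes bil: "bilinear k" and sym: "\<And>x y. k x y = k y x" and lin: "linear l"
    and e: "k e e = \<mu> *\<^sub>R e" "e \<noteq> 0" "\<mu> \<noteq> 0"
    and quartic: "\<And>h. (5 * l (k h h)) *\<^sub>R k h h = (2 * l h) *\<^sub>R k h (k h h)"
  shows "l v = 0"
proof -
  note [simp] = bilinear_ladd[OF bil] bilinear_radd[OF bil] bilinear_lmul[OF bil] bilinear_rmul[OF bil]
    linear_add[OF lin] linear_scale[OF lin]
  have "(3 * \<mu>^2 * l e) *\<^sub>R e = 0"
  proof -
    have "(5 * \<mu>^2 * l e) *\<^sub>R e - (2 * \<mu>^2 * l e) *\<^sub>R e = 0"
      using quartic[of e] by (simp add: e(1) mult_ac power2_eq_square)
    then show ?thesis
      by (auto simp flip: scaleR_left_diff_distrib)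
  qed
  then have le: "l e = 0"
    using e by simp
  define L where "L = k e"
  have L: "k e x = L x" "k x e = L x" for x
    by (simp_all add: L_def sym)
  have Le: "L e = \<mu> *\<^sub>R e"
    by (simp add: L_def e(1))
  have lL: "linear L"
    using bil by (simp add: L_def bilinear_def)
  note [simp] = L Le linear_add[OF lL] linear_scale[OF lL]
  have c: "(10 * l (L v) * \<mu>) *\<^sub>R e - (2 * l v * \<mu>^2) *\<^sub>R e = 0" (is "?A v = 0")
      "(5 * l (k v v) * \<mu>) *\<^sub>R e + (20 * l (L v)) *\<^sub>R L v
        - (2 * l v * \<mu>) *\<^sub>R L v - (4 * l v) *\<^sub>R L (L v) = 0" (is "?B v = 0") for v
  proof -
    define c1 where "c1 = (10 * l (L v) * \<mu>) *\<^sub>R e - (2 * l v * \<mu>^2) *\<^sub>R e"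
    define c2 where "c2 = (5 * l (k v v) * \<mu>) *\<^sub>R e + (20 * l (L v)) *\<^sub>R L v
      - (2 * l v * \<mu>) *\<^sub>R L v - (4 * l v) *\<^sub>R L (L v)"
    define c3 where "c3 = (10 * l (L v)) *\<^sub>R k v v + (10 * l (k v v)) *\<^sub>R L v
      - (2 * l v) *\<^sub>R (L (k v v) + 2 *\<^sub>R k v (L v))"
    define c4 where "c4 = (5 * l (k v v)) *\<^sub>R k v v - (2 * l v) *\<^sub>R k v (k v v)"
    have sq: "k (e + t *\<^sub>R v) (e + t *\<^sub>R v) = \<mu> *\<^sub>R e + (2 * t) *\<^sub>R L v + t^2 *\<^sub>R k v v" for t
      by (rule euclidean_eqI) (simp add: inner_add_left algebra_simps power2_eq_square)
    have cub: "k (e + t *\<^sub>R v) (\<mu> *\<^sub>R e + (2 * t) *\<^sub>R L v + t^2 *\<^sub>R k v v)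
       = \<mu>^2 *\<^sub>R e + t *\<^sub>R (\<mu> *\<^sub>R L v + 2 *\<^sub>R L (L v)) + t^2 *\<^sub>R (L (k v v) + 2 *\<^sub>R k v (L v))
         + t^3 *\<^sub>R k v (k v v)" for t
      by (simp add: algebra_simps power2_eq_square power3_eq_cube)
    have "t *\<^sub>R c1 + t^2 *\<^sub>R c2 + t^3 *\<^sub>R c3 + t^4 *\<^sub>R c4 = 0" for t
    proof -
      have "(5 * (2 * t * l (L v) + t^2 * l (k v v))) *\<^sub>R (\<mu> *\<^sub>R e + (2 * t) *\<^sub>R L v + t^2 *\<^sub>R k v v)
        = (2 * (t * l v)) *\<^sub>R (\<mu>^2 *\<^sub>R e + t *\<^sub>R (\<mu> *\<^sub>R L v + 2 *\<^sub>R L (L v)) 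
          + t^2 *\<^sub>R (L (k v v) + 2 *\<^sub>R k v (L v)) + t^3 *\<^sub>R k v (k v v))"
        using quartic[of "e + t *\<^sub>R v"] by (simp add: sq cub le del: bilinear_ladd[OF bil] bilinear_radd[OF bil])
      then have "(5 * (2 * t * l (L v) + t^2 * l (k v v))) *\<^sub>R (\<mu> *\<^sub>R e + (2 * t) *\<^sub>R L v + t^2 *\<^sub>R k v v)
        - (2 * (t * l v)) *\<^sub>R (\<mu>^2 *\<^sub>R e + t *\<^sub>R (\<mu> *\<^sub>R L v + 2 *\<^sub>R L (L v)) 
          + t^2 *\<^sub>R (L (k v v) + 2 *\<^sub>R k v (L v)) + t^3 *\<^sub>R k v (k v v)) = 0"
        by simp
      moreover have "(5 * (2 * t * l (L v) + t^2 * l (k v v))) *\<^sub>R (\<mu> *\<^sub>R e + (2 * t) *\<^sub>R L v + t^2 *\<^sub>R k v v)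
        - (2 * (t * l v)) *\<^sub>R (\<mu>^2 *\<^sub>R e + t *\<^sub>R (\<mu> *\<^sub>R L v + 2 *\<^sub>R L (L v)) 
          + t^2 *\<^sub>R (L (k v v) + 2 *\<^sub>R k v (L v)) + t^3 *\<^sub>R k v (k v v))
         = t *\<^sub>R c1 + t^2 *\<^sub>R c2 + t^3 *\<^sub>R c3 + t^4 *\<^sub>R c4"
        unfolding c1_def c2_def c3_def c4_def
        by (rule euclidean_eqI) (simp add: inner_add_left inner_diff_left algebra_simps power_numeral_reduce)
      ultimately show ?thesis by simp
    qed
    from quartic_polynomial_zero_coeffs[OF this] show "?A v = 0" "?B v = 0"
      by (simp_all add: c1_def c2_def)
  qed
  have "(10 * l (L v) * \<mu> - 2 * l v * \<mu>^2) *\<^sub>R e = 0" for v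
    using c(1)[of v] by (simp add: scaleR_left_diff_distrib)
  then have lLv: "l (L v) = \<mu> / 5 * l v" for v
    using e by (simp add: field_simps power2_eq_square)
  have "l ((5 * l (k v v) * \<mu>) *\<^sub>R e + (20 * l (L v)) *\<^sub>R L v
        - (2 * l v * \<mu>) *\<^sub>R L v - (4 * l v) *\<^sub>R L (L v)) = 0"
    unfolding c(2) by (rule linear_0[OF lin])
  then have "6 / 25 * \<mu>^2 * l v * l v = 0"
    by (simp add: linear_diff[OF lin] le lLv power2_eq_square)
  then show ?thesis
    using e by simp
qed

text \<open>
  A maximum \<^term>\<open>e\<close> of \<open>|T|\<close>, \<open>T h = k h h \<bullet> h\<close>, on the unit sphere is an eigenvector by the
  Lagrange condition, and \<open>T e \<noteq> 0\<close> by polarization.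
\<close>
lemma cubic_form_eigenvector:
  fixes k :: "'a::euclidean_space \<Rightarrow> 'a \<Rightarrow> 'a"
  assumes bil: "bilinear k" and sym: "\<And>x y. k x y = k y x"
    and tot: "\<And>x y z. k x y \<bullet> z = k x z \<bullet> y" and nz: "k x0 y0 \<noteq> 0"
  obtains e \<mu> where "e \<noteq> 0" "\<mu> \<noteq> 0" "k e e = \<mu> *\<^sub>R e"
proof -
  note [simp] = bilinear_ladd[OF bil] bilinear_radd[OF bil] bilinear_lmul[OF bil] bilinear_rmul[OF bil]
  interpret bounded_bilinear k
    using bil bilinear_conv_bounded_bilinear by blast
  define T where "T h = k h h \<bullet> h" for h
  have perm: "k x z \<bullet> y = k x y \<bullet> z" "k y x \<bullet> z = k x y \<bullet> z" "k y z \<bullet> x = k x y \<bullet> z"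
     "k z x \<bullet> y = k x y \<bullet> z" "k z y \<bullet> x = k x y \<bullet> z" for x y z
    using tot sym by metis+
  have polar: "6 * (k x y \<bullet> z) = T (x + y + z) - T (x + y) - T (y + z) - T (x + z) + T x + T y + T z" for x y z
    unfolding T_def bilinear_ladd[OF bil] bilinear_radd[OF bil] inner_add_left inner_add_right
    using perm[of x y z] perm[of x x y] perm[of x x z] perm[of y y x] perm[of y y z] perm[of z z x] perm[of z z y]
    by linarith
  have "\<exists>h. T h \<noteq> 0"
  proof (rule ccontr)
    assume "\<not> (\<exists>h. T h \<noteq> 0)"
    then show False using polar[of x0 y0 "k x0 y0"] nz by simp
  qed
  then obtain h0 where h0: "T h0 \<noteq> 0" by blast
  then have h0nz: "h0 \<noteq> 0"
    by (auto simp: T_def)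
  have T_scale: "T (r *\<^sub>R h) = r^3 * T h" for r h
    by (simp add: T_def power3_eq_cube)
  have "continuous_on (sphere 0 1) (\<lambda>h. \<bar>T h\<bar>)"
    unfolding T_def by (intro continuous_intros continuous_on)
  moreover have "sphere (0::'a) 1 \<noteq> {}"
    by simp
  ultimately obtain e where e: "norm e = 1" and mx: "\<And>h. norm h = 1 \<Longrightarrow> \<bar>T h\<bar> \<le> \<bar>T e\<bar>"
    using continuous_attains_sup[of "sphere (0::'a) 1" "\<lambda>h. \<bar>T h\<bar>"] by auto
  have bound: "\<bar>T h\<bar> \<le> \<bar>T e\<bar> * norm h ^ 3" for h
  proof (cases "h = 0")
    case True then show ?thesis by (simp add: T_def)
  next
    case False
    have "T h = norm h ^ 3 * T (h /\<^sub>R norm h)"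
      using False by (subst T_scale) (simp add: field_simps)
    then show ?thesis
      using mx[of "h /\<^sub>R norm h"] False by (simp add: abs_mult mult.commute mult_right_mono)
  qed
  have "T e \<noteq> 0"
    using bound[of h0] h0 by auto
  have "k e e \<bullet> z = 0" if z: "e \<bullet> z = 0" for z
  proof -
    \<comment> \<open>The maximality \<open>T(h)\<^sup>2 \<le> T(e)\<^sup>2 |h|\<^sup>6\<close> along \<open>h = e + t z\<close>, squared to stay polynomial
      in \<open>t\<close>; its slope at 0 is \<open>- 6 T(e) (k e e \<bullet> z)\<close>.\<close>
    define g where "g t = (T e)^2 * (1 + t^2 * (z \<bullet> z))^3 - (T e + 3 * t * (k e e \<bullet> z) + 3 * t^2 * (k e z \<bullet> z) + t^3 * T z)^2" for t :: real
    have ge: "g t \<ge> 0" for t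
    proof -
      have "(norm (e + t *\<^sub>R z))^2 = 1 + t^2 * (z \<bullet> z)"
        using e z unfolding power2_norm_eq_inner
        by (simp add: inner_add_left inner_add_right inner_commute norm_eq_1 power2_eq_square)
      then have n6: "(norm (e + t *\<^sub>R z) ^ 3)^2 = (1 + t^2 * (z \<bullet> z))^3"
        by (metis power_even_eq power_mult mult.commute)
      have "T (e + t *\<^sub>R z) = T e + 3 * t * (k e e \<bullet> z) + 3 * t^2 * (k e z \<bullet> z) + t^3 * T z"
        using perm[of e e z] perm[of e z z] perm[of z z e]
        by (simp add: T_def inner_add_left inner_add_right algebra_simps power2_eq_square power3_eq_cube)
      moreover have "(T (e + t *\<^sub>R z))^2 \<le> (T e * norm (e + t *\<^sub>R z) ^ 3)^2"
        using bound[of "e + t *\<^sub>R z"] by (intro abs_le_square_iff[THEN iffD1]) (simp add: abs_mult)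
      ultimately show ?thesis
        unfolding g_def power_mult_distrib n6 by simp
    qed
    have "(g has_real_derivative - 6 * T e * (k e e \<bullet> z)) (at 0)"
      unfolding g_def by (auto intro!: derivative_eq_intros)
    moreover have "g 0 = 0"
      by (simp add: g_def)
    ultimately have "- 6 * T e * (k e e \<bullet> z) = 0"
      using ge by (intro DERIV_local_min[of g _ 0 1]) auto
    then show ?thesis
      using \<open>T e \<noteq> 0\<close> by simp
  qed
  moreover have "e \<bullet> (k e e - T e *\<^sub>R e) = 0"
    using e by (simp add: inner_diff_right T_def inner_commute norm_eq_1)
  ultimately have orth: "k e e \<bullet> (k e e - T e *\<^sub>R e) = 0" "e \<bullet> (k e e - T e *\<^sub>R e) = 0"
    by blast+
  have "(k e e - T e *\<^sub>R e) \<bullet> (k e e - T e *\<^sub>R e) = 0"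
    unfolding inner_diff_left[of "k e e"] using orth by simp
  then have "k e e = T e *\<^sub>R e" by simp
  with that[of e "T e"] e \<open>T e \<noteq> 0\<close> show ?thesis by force
qed

lemma quartic_identity_imp_constant:
  fixes k :: "'a::euclidean_space \<Rightarrow> 'a \<Rightarrow> 'a"
  assumes f: "smooth_on \<Omega> f" "open \<Omega>" and "connected \<Omega>"
    and k: "bilinear k" and sym: "\<And>x y. k x y = k y x"
    and tot: "\<And>x y z. k x y \<bullet> z = k x z \<bullet> y" and nz: "k X0 Y0 \<noteq> 0"
    and quartic: "\<And>x h. x \<in> \<Omega> \<Longrightarrow> (5 * f x * frechet_derivative f (at x) (k h h)) *\<^sub>R k h h
       = (2 * f x * frechet_derivative f (at x) h) *\<^sub>R k h (k h h)"
  shows "f constant_on \<Omega>"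
proof -
  obtain e \<mu> where e: "e \<noteq> 0" "\<mu> \<noteq> 0" "k e e = \<mu> *\<^sub>R e"
    using cubic_form_eigenvector[OF k sym tot nz] by blast
  have zero: "f x * frechet_derivative f (at x) v = 0" if x: "x \<in> \<Omega>" for x v
  proof (cases "f x = 0")
    case False
    have lin: "linear (frechet_derivative f (at x))"
      using smooth_on_has_derivative[OF f x] has_derivative_linear by blast
    have "(5 * frechet_derivative f (at x) (k h h)) *\<^sub>R k h h = (2 * frechet_derivative f (at x) h) *\<^sub>R k h (k h h)" for h
    proof -
      have "f x *\<^sub>R ((5 * frechet_derivative f (at x) (k h h)) *\<^sub>R k h h) = f x *\<^sub>R ((2 * frechet_derivative f (at x) h) *\<^sub>R k h (k h h))"
        unfolding scaleR_scaleR using quartic[OF x, of h] by (metis mult.assoc mult.commute)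
      then show ?thesis by (rule scaleR_left_imp_eq[OF False])
    qed
    from quartic_identity_forces_zero[OF k sym lin e(3,1,2) this] show ?thesis
      by simp
  qed simp
  have "((\<lambda>y. f y * f y) has_derivative (\<lambda>v. 0)) (at x)" if x: "x \<in> \<Omega>" for x
    using has_derivative_mult[OF smooth_on_has_derivative[OF f x] smooth_on_has_derivative[OF f x]] zero[OF x]
    by (simp add: mult.commute)
  then have sq: "f y * f y = f x * f x" if "x \<in> \<Omega>" "y \<in> \<Omega>" for x y
    using has_derivative_zero_unique_connected[of \<Omega> "\<lambda>y. f y * f y"] \<open>connected \<Omega>\<close> f(2) that by blast
  have "f ` \<Omega> \<subseteq> {f x, - f x}" if "x \<in> \<Omega>" for x
    using sq[OF that] by (auto simp: square_eq_iff)
  then have "finite (f ` \<Omega>)"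
    by (metis finite.emptyI finite.insertI finite_subset image_is_empty all_not_in_conv)
  then show ?thesis
    using continuous_finite_range_constant \<open>connected \<Omega>\<close> smooth_on_continuous_on[OF f(1)] by blast
qed

section \<open>Tensors proportional to a constant tensor\<close>

lemma assoc_tensor_constant:
  fixes C1 :: "'a::euclidean_space tensor3"
  assumes "symmetric_tensor3 C1"
  defines "k \<equiv> assoc_tensor (\<lambda>_. C1) undefined"
  shows "k X Y \<bullet> Z = C1 X Y Z" "bilinear k" "k X Y = k Y X" "k X Y \<bullet> Z = k X Z \<bullet> Y"
proof -
  have inner: "k X Y \<bullet> Z = C1 X Y Z" for X Y Z
    unfolding k_def using inner_assoc_tensor[of "\<lambda>_. C1"] assms(1) by blast
  then show "k X Y \<bullet> Z = C1 X Y Z" .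
  have ext: "v = w" if "\<And>Z. v \<bullet> Z = w \<bullet> Z" for v w :: 'a
    using that vector_eq_rdot by blast
  show "k X Y = k Y X" "k X Y \<bullet> Z = k X Z \<bullet> Y"
    using assms(1) by (auto intro: ext simp: inner symmetric_tensor3_def)
  show "bilinear k"
    unfolding bilinear_def
    using assms(1) by (intro allI conjI linearI ext)
      (auto simp: inner inner_add_left symmetric_tensor3_def linear_add linear_scale)
qed

lemma assoc_tensor_scaled:
  fixes C1 :: "'a::euclidean_space tensor3"
  assumes C1: "symmetric_tensor3 C1" and C: "\<And>X Y Z. C x X Y Z = c * C1 X Y Z"
  shows "assoc_tensor C x X Y = c *\<^sub>R assoc_tensor (\<lambda>_. C1) undefined X Y"
  unfolding assoc_tensor_def[of C]
proof (rule the_equality)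
  show "\<forall>Z. (c *\<^sub>R assoc_tensor (\<lambda>_. C1) undefined X Y) \<bullet> Z = C x X Y Z"
    by (simp add: C assoc_tensor_constant(1)[OF C1])
  fix w assume "\<forall>Z. w \<bullet> Z = C x X Y Z"
  then show "w = c *\<^sub>R assoc_tensor (\<lambda>_. C1) undefined X Y"
    by (subst vector_eq_rdot[symmetric]) (simp add: C assoc_tensor_constant(1)[OF C1])
qed

lemma tensor_deriv_scaled:
  fixes k :: "'a::euclidean_space tensor12"
  assumes f: "smooth_on \<Omega> f" "open \<Omega>" and x: "x \<in> \<Omega>"
  shows "tensor_deriv v (\<lambda>y X Y. f y *\<^sub>R k X Y) x X Y = frechet_derivative f (at x) v *\<^sub>R k X Y"
proof -
  have line: "((\<lambda>t. x + t *\<^sub>R v) has_vector_derivative v) (at 0)"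
    by (auto intro!: derivative_eq_intros)
  have "((\<lambda>t. f (x + t *\<^sub>R v)) has_real_derivative frechet_derivative f (at x) v) (at 0)"
    using has_real_derivative_along_curve[OF f _ line] x by simp
  from has_vector_derivative_scaleR[OF this has_vector_derivative_const[of "k X Y"]]
  show ?thesis
    unfolding tensor_deriv_def dir_deriv_def by (simp add: vector_derivative_at)
qed

text \<open>
  With \<open>K = f k\<close> the first and third terms of the obstruction are both multiples of
  \<open>df(h) k(h, k(h, h))\<close>, with coefficients \<open>2 - 4 = - 2\<close>.
\<close>
lemma obstruction_scaled:
  fixes k :: "'a::euclidean_space tensor12"
  assumes f: "smooth_on \<Omega> f" "open \<Omega>" and x: "x \<in> \<Omega>" and k: "bilinear k"
  shows "obstruction (\<lambda>y X Y. f y *\<^sub>R k X Y) x h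
    = (5 * f x * frechet_derivative f (at x) (k h h)) *\<^sub>R k h h
      - (2 * f x * frechet_derivative f (at x) h) *\<^sub>R k h (k h h)"
  unfolding obstruction_def tensor_deriv_scaled[OF f x] frechet_derivative_linear[OF f x] bilinear_rmul[OF k]
  by (rule euclidean_eqI) (simp add: inner_diff_left inner_add_left algebra_simps)

lemma constant_on_imp_constant_tensor3_field:
  assumes "open \<Omega>" "\<And>X Y Z. (\<lambda>x. C x X Y Z) constant_on \<Omega>"
  shows "constant_tensor3_field \<Omega> C"
  unfolding constant_tensor3_field_def
proof (intro ballI allI)
  fix x v X Y Z assume x: "x \<in> \<Omega>"
  have "open ((\<lambda>t::real. x + t *\<^sub>R v) -` \<Omega>)"
    by (intro open_vimage assms(1) continuous_intros)
  moreover have "0 \<in> (\<lambda>t::real. x + t *\<^sub>R v) -` \<Omega>"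
    using x by simp
  moreover have "C x X Y Z = C (x + t *\<^sub>R v) X Y Z" if "t \<in> (\<lambda>t::real. x + t *\<^sub>R v) -` \<Omega>" for t
    using assms(2)[of X Y Z] x that unfolding constant_on_def by auto
  ultimately have "((\<lambda>t. C (x + t *\<^sub>R v) X Y Z) has_vector_derivative 0) (at 0)"
    by (rule has_vector_derivative_transform_within_open[OF has_vector_derivative_const])
  then show "dir_deriv v (\<lambda>y. C y X Y Z) x = 0"
    unfolding dir_deriv_def by (rule vector_derivative_at)
qed

lemma one_dimensional_tensor3_field:
  fixes C :: "'a::euclidean_space \<Rightarrow> 'a tensor3"
  assumes C: "smooth_symmetric_tensor3_field \<Omega> C" and dim: "DIM('a) = 1"
  obtains f C1 where "smooth_on \<Omega> f" "symmetric_tensor3 C1" "\<And>x X Y Z. x \<in> \<Omega> \<Longrightarrow> C x X Y Z = f x * C1 X Y Z"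
proof -
  obtain b :: 'a where b: "Basis = {b}"
    using dim card_1_singletonE by blast
  have rep: "X = (X \<bullet> b) *\<^sub>R b" for X :: 'a
    using euclidean_representation[of X] by (simp add: b)
  show ?thesis
  proof (rule that)
    show "smooth_on \<Omega> (\<lambda>x. C x b b b)"
      using C by (simp add: smooth_symmetric_tensor3_field_def)
    show "symmetric_tensor3 (\<lambda>X Y Z. (X \<bullet> b) * (Y \<bullet> b) * (Z \<bullet> b))"
      by (auto simp: symmetric_tensor3_def inner_add_left algebra_simps intro!: linearI)
    fix x X Y Z assume "x \<in> \<Omega>"
    then have "symmetric_tensor3 (C x)"
      using C by (simp add: smooth_symmetric_tensor3_field_def)
    then have "C x ((X \<bullet> b) *\<^sub>R b) ((Y \<bullet> b) *\<^sub>R b) ((Z \<bullet> b) *\<^sub>R b) = (X \<bullet> b) *\<^sub>R (Y \<bullet> b) *\<^sub>R (Z \<bullet> b) *\<^sub>R C x b b b"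
      unfolding symmetric_tensor3_def by (simp add: linear_scale)
    then show "C x X Y Z = C x b b b * ((X \<bullet> b) * (Y \<bullet> b) * (Z \<bullet> b))"
      using rep[of X] rep[of Y] rep[of Z] by simp
  qed
qed

section \<open>The rigidity theorem\<close>

theorem theorem9p3:
  shows "(\<forall>(\<Omega>::'a::euclidean_space set) (C1::'a tensor3) (f::'a \<Rightarrow> real) (K::'a \<Rightarrow> 'a tensor12).
            open \<Omega> \<and> connected \<Omega> \<and>
            symmetric_tensor3 C1 \<and> C1 \<noteq> (\<lambda>_ _ _. 0) \<and>
            smooth_on \<Omega> f \<and>
            K = assoc_tensor (\<lambda>x X Y Z. f x * C1 X Y Z) \<and>
            (\<forall>x\<in>\<Omega>. \<forall>h. obstruction K x h = 0)
            \<longrightarrow> f constant_on \<Omega>)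
       \<and> (\<forall>(\<Omega>::'a set) (C::'a \<Rightarrow> 'a tensor3).
            open \<Omega> \<and> connected \<Omega> \<and>
            smooth_symmetric_tensor3_field \<Omega> C \<and>
            local_midpoint_invariance \<Omega> C \<and>
            (DIM('a) = 1 \<or>
             (\<exists>f C1. smooth_on \<Omega> f \<and> symmetric_tensor3 C1 \<and>
                (\<forall>x\<in>\<Omega>. \<forall>X Y Z. C x X Y Z = f x * C1 X Y Z)))
            \<longrightarrow> constant_tensor3_field \<Omega> C)"
proof (intro conjI allI impI; elim conjE)
  fix \<Omega> :: "'a set" and C1 :: "'a tensor3" and f :: "'a \<Rightarrow> real" and K :: "'a \<Rightarrow> 'a tensor12"
  assume \<Omega>: "open \<Omega>" "connected \<Omega>" and C1: "symmetric_tensor3 C1" "C1 \<noteq> (\<lambda>_ _ _. 0)" and f: "smooth_on \<Omega> f"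
    and K: "K = assoc_tensor (\<lambda>x X Y Z. f x * C1 X Y Z)" and obs: "\<forall>x\<in>\<Omega>. \<forall>h. obstruction K x h = 0"
  define k where "k = assoc_tensor (\<lambda>_. C1) undefined"
  note k = assoc_tensor_constant[OF C1(1), folded k_def]
  have K_k: "K = (\<lambda>y X Y. f y *\<^sub>R k X Y)"
    unfolding K k_def by (intro ext assoc_tensor_scaled C1) simp
  obtain X0 Y0 Z0 where "C1 X0 Y0 Z0 \<noteq> 0"
    using C1(2) by (auto simp: fun_eq_iff)
  then have "k X0 Y0 \<noteq> 0"
    using k(1)[of X0 Y0 Z0] by auto
  from quartic_identity_imp_constant[OF f \<Omega> k(2,3,4) this] show "f constant_on \<Omega>"
    using obs obstruction_scaled[OF f \<Omega>(1) _ k(2)] by (simp add: K_k)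
next
  fix \<Omega> :: "'a set" and C :: "'a \<Rightarrow> 'a tensor3"
  assume \<Omega>: "open \<Omega>" "connected \<Omega>" and C: "smooth_symmetric_tensor3_field \<Omega> C" and inv: "local_midpoint_invariance \<Omega> C"
    and "DIM('a) = 1 \<or> (\<exists>f C1. smooth_on \<Omega> f \<and> symmetric_tensor3 C1 \<and>
                (\<forall>x\<in>\<Omega>. \<forall>X Y Z. C x X Y Z = f x * C1 X Y Z))"
  then obtain f C1 where f: "smooth_on \<Omega> f" and C1: "symmetric_tensor3 C1"
    and C_f: "\<And>x X Y Z. x \<in> \<Omega> \<Longrightarrow> C x X Y Z = f x * C1 X Y Z"
    using one_dimensional_tensor3_field[OF C] by metis
  define k where "k = assoc_tensor (\<lambda>_. C1) undefined"
  note k = assoc_tensor_constant[OF C1, folded k_def]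
  have K: "assoc_tensor C y X Y = f y *\<^sub>R k X Y" if "y \<in> \<Omega>" for y X Y
    unfolding k_def by (rule assoc_tensor_scaled[where C=C and x=y, OF C1]) (rule C_f[OF that])
  obtain U W U' W' N where ch: "midpoint_chart \<Omega> (assoc_tensor C) U W"
      "midpoint_chart \<Omega> (\<lambda>x X Y. - assoc_tensor C x X Y) U' W'"
    and N: "open N" "diagonal \<Omega> \<subseteq> N" "N \<subseteq> W \<inter> W'"
    and mid: "\<forall>(P, Q)\<in>N. midpoint_map \<Omega> (assoc_tensor C) U P Q
        + midpoint_map \<Omega> (\<lambda>x X Y. - assoc_tensor C x X Y) U' P Q = P + Q"
    using inv unfolding local_midpoint_invariance_def Let_def by blast
  have quartic: "(5 * f x * frechet_derivative f (at x) (k h h)) *\<^sub>R k h h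
       = (2 * f x * frechet_derivative f (at x) h) *\<^sub>R k h (k h h)" if "x \<in> \<Omega>" for x h
    by (rule midpoint_invariance_obstruction[OF f \<Omega>(1) k(2,3) _ _ ch N _ that]) (use K mid in auto)
  show "constant_tensor3_field \<Omega> C"
  proof (rule constant_on_imp_constant_tensor3_field[OF \<Omega>(1)])
    fix X Y Z
    show "(\<lambda>x. C x X Y Z) constant_on \<Omega>"
    proof (cases "k X Y = 0")
      case True
      then have "C1 X Y Z = 0"
        using k(1)[of X Y Z] by simp
      then show ?thesis
        by (auto simp: constant_on_def C_f)
    next
      case False
      from quartic_identity_imp_constant[OF f \<Omega> k(2,3,4) this quartic]
      show ?thesis
        by (auto simp: constant_on_def C_f)
    qed
  qed
qed

end
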